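(* Let $p\in[1,\infty]$, $p\neq2$, and let $r$ be defined by $1/r=1+|1/2-1/p|$. Let $E=l_p$ if $p<\infty$ and $E=c_0$ if $p=\infty$. Then there exists a nuclear operator $V:E\to E$ such that: (1) $V\in N_s(E)$ for each $s\in(r,1]$; (2) $V\notin N_r(E)$; (3) $\operatorname{trace} V=1$ and $V^2=0$.
   Context: Convention: $1/\infty=0$; Banach spaces are complex. For a Banach space $X$ and $0<s\le1$, $N_s(X)$ is the set of $s$-nuclear operators in $X$, i.e. operators $T:X\to X$ of the form $T(x)=\sum_{k=1}^\infty\langle x'_k,x\rangle x_k$ with $x'_k\in X^*$, $x_k\in X$ and $\sum_k\|x'_k\|^s\|x_k\|^s<\infty$. Nuclear means $1$-nuclear. The spaces $l_p$ and $c_0$ have the approximation property, so for a nuclear operator $T$ on $E$ the nuclear trace $\operatorname{trace} T:=\sum_k\langle x'_k,x_k\rangle$ does not depend on the choice of the representation $T=\sum_k\langle x'_k,\cdot\rangle x_k$ with $\sum_k\|x'_k\|\,\|x_k\|<\infty$. *)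

theory Defs
  imports "HOL-Analysis.Analysis"
begin

text \<open>
  The exponent \<open>p\<close> is a value, so the spaces \<open>l\<^sub>p\<close> cannot be types.  A complex Banach space of
  sequences is given by its carrier and its norm; the vector operations are pointwise.
  Operators and functionals are total functions, of which only the restriction to the carrier
  is meaningful.
\<close>

type_synonym cseq = "nat \<Rightarrow> complex"

record seq_space =
  vecs :: "cseq set"
  vnorm :: "cseq \<Rightarrow> real"

definition lp_space :: "real \<Rightarrow> seq_space" where
  "lp_space p =
    \<lparr> vecs = {x. summable (\<lambda>i. cmod (x i) powr p)},
      vnorm = (\<lambda>x. (\<Sum>i. cmod (x i) powr p) powr (1 / p)) \<rparr>"

definition c0_space :: seq_space where
  "c0_space = \<lparr> vecs = {x. x \<longlonglongrightarrow> 0}, vnorm = (\<lambda>x. SUP i. cmod (x i)) \<rparr>"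

definition lp_or_c0 :: "ereal \<Rightarrow> seq_space" where
  "lp_or_c0 p = (if p = \<infinity> then c0_space else lp_space (real_of_ereal p))"

definition dual :: "seq_space \<Rightarrow> (cseq \<Rightarrow> complex) set" where
  "dual E = {f.
     (\<forall>x\<in>vecs E. \<forall>y\<in>vecs E. f (\<lambda>i. x i + y i) = f x + f y) \<and>
     (\<forall>c. \<forall>x\<in>vecs E. f (\<lambda>i. c * x i) = c * f x) \<and>
     (\<exists>B. \<forall>x\<in>vecs E. cmod (f x) \<le> B * vnorm E x)}"

definition dual_norm :: "seq_space \<Rightarrow> (cseq \<Rightarrow> complex) \<Rightarrow> real" where
  "dual_norm E f = (SUP x\<in>{x\<in>vecs E. vnorm E x \<le> 1}. cmod (f x))"

definition operators :: "seq_space \<Rightarrow> (cseq \<Rightarrow> cseq) set" where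
  "operators E = {T.
     (\<forall>x\<in>vecs E. T x \<in> vecs E) \<and>
     (\<forall>x\<in>vecs E. \<forall>y\<in>vecs E. T (\<lambda>i. x i + y i) = (\<lambda>i. T x i + T y i)) \<and>
     (\<forall>c. \<forall>x\<in>vecs E. T (\<lambda>i. c * x i) = (\<lambda>i. c * T x i)) \<and>
     (\<exists>B. \<forall>x\<in>vecs E. vnorm E (T x) \<le> B * vnorm E x)}"

text \<open>
  \<open>T = (\<Sum>k. \<langle>f k, \<cdot>\<rangle> v k)\<close> is an \<open>s\<close>-nuclear representation; for each argument the series
  converges in the norm of \<open>E\<close>.
\<close>

definition nuclear_rep ::
    "seq_space \<Rightarrow> real \<Rightarrow> (cseq \<Rightarrow> cseq) \<Rightarrow> (nat \<Rightarrow> cseq \<Rightarrow> complex) \<Rightarrow> (nat \<Rightarrow> cseq) \<Rightarrow> bool" where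
  "nuclear_rep E s T f v \<longleftrightarrow>
     (\<forall>k. f k \<in> dual E) \<and> (\<forall>k. v k \<in> vecs E) \<and>
     summable (\<lambda>k. dual_norm E (f k) powr s * vnorm E (v k) powr s) \<and>
     (\<forall>x\<in>vecs E. (\<lambda>n. vnorm E (\<lambda>i. T x i - (\<Sum>k<n. f k x * v k i))) \<longlonglongrightarrow> 0)"

definition nuclear_ops :: "seq_space \<Rightarrow> real \<Rightarrow> (cseq \<Rightarrow> cseq) set" where
  "nuclear_ops E s = {T \<in> operators E. \<exists>f v. nuclear_rep E s T f v}"

text \<open>
  The description is proper for nuclear \<open>T\<close> whenever \<open>E\<close> has the approximation property, since
  then the sum is the same for all representations.
\<close>

definition nuclear_trace :: "seq_space \<Rightarrow> (cseq \<Rightarrow> cseq) \<Rightarrow> complex" where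
  "nuclear_trace E T = (THE t. \<exists>f v. nuclear_rep E 1 T f v \<and> (\<lambda>k. f k (v k)) sums t)"

end

theory Submission
  imports Defs "HOL-Real_Asymp.Real_Asymp"
begin

text \<open>
  The operator is given by a matrix of Enflo-Davie type that is independent of \<open>p\<close>.  On the block
  \<open>k\<close> of \<open>4 * 2 ^ k\<close> coordinates choose orthonormal systems \<open>p k j\<close> (\<open>j < 2 * 2 ^ k\<close>) and
  \<open>q k j\<close> (\<open>j < 2 ^ k\<close>) from the rows of a Hadamard matrix and let \<open>A\<close> be the sum over \<open>k\<close> of
  \<open>2\<close> to the power \<open>- (k + 1)\<close> times the rank one matrices \<open>z k j \<otimes> w k j\<close>, where
  \<open>z k j = \<mu> p k j + q (k + 1) j\<close> and \<open>w k j = p k j / \<mu> - q (k + 1) j\<close> with \<open>\<mu> = k + 1\<close>.  Every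
  \<open>w\<close> is orthogonal to every \<open>z\<close>, so the square of \<open>A\<close> is \<open>0\<close>, and the trace telescopes to \<open>1\<close>.
  Random signs, realised by a potential argument with \<open>cosh\<close>, select the rows such that the
  entries on a block of size \<open>n\<close> are at most \<open>n\<close> to the power \<open>- 3 / 2\<close> up to logarithms.  Expanding
  along rows (for \<open>p \<le> 2\<close>) or columns (for \<open>p \<ge> 2\<close>) gives \<open>s\<close>-nuclearity for all \<open>s > r\<close>.

  For the exponent \<open>r\<close>, compress a representation to the off-diagonal block between the levels
  \<open>k\<close> and \<open>k + 1\<close>.  Up to unitaries this block is \<open>\<tau>\<close> times the identity of dimension
  \<open>m = 2 * 2 ^ k\<close> with \<open>\<tau> m = k + 1\<close>.  In Hilbert space an \<open>r\<close>-nuclear representation of it costs at least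
  \<open>\<tau> powr r * m / 2\<close>, and passing to the norm of \<open>E\<close> loses only a power \<open>\<bar>1 / 2 - 1 / p\<bar>\<close> of the
  dimension.  For the critical \<open>r\<close> a multiple of \<open>(k + 1) powr r\<close> remains, which is unbounded.
\<close>

subsection \<open>Balanced signs and Hadamard matrices\<close>

text \<open>The linear terms of the quadratic bounds for \<open>exp y\<close> and
  \<open>exp (- y)\<close> on [0, 1] cancel in the sum. This is the sub-Gaussian estimate for one
  random sign, whose exponential moment is \<open>cosh\<close>.\<close>

lemma cosh_le_exp_power2:
  fixes x :: real
  assumes "\<bar>x\<bar> \<le> 1"
  shows "cosh x \<le> exp (x\<^sup>2)"
proof -
  have *: "exp y + exp (- y) \<le> 2 * (1 + y\<^sup>2)" if y: "0 \<le> y" "y \<le> 1" for y :: real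
  proof -
    have "exp y \<le> 1 + y + y\<^sup>2"
      using exp_bound y by blast
    moreover have "exp (- y) \<le> 1 - y + y\<^sup>2"
    proof -
      have "exp (- y) = 1 / exp y"
        by (simp add: exp_minus field_simps)
      also have "\<dots> \<le> 1 / (1 + y)"
        using exp_ge_add_one_self[of y] y by (intro divide_left_mono) auto
      also have "\<dots> \<le> 1 - y + y\<^sup>2"
      proof -
        have "(1 - y + y\<^sup>2) * (1 + y) = 1 + y ^ 3"
          by (simp add: algebra_simps power2_eq_square power3_eq_cube)
        then show ?thesis
          using y by (simp add: divide_le_eq)
      qed
      finally show ?thesis .
    qed
    ultimately show ?thesis by simp
  qed
  have "exp x + exp (- x) \<le> 2 * (1 + x\<^sup>2)"
    using *[of x] *[of "- x"] assms by (cases "0 \<le> x") auto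
  then have "cosh x \<le> 1 + x\<^sup>2"
    by (simp add: cosh_field_def)
  also have "\<dots> \<le> exp (x\<^sup>2)"
    by (rule exp_ge_add_one_self)
  finally show ?thesis .
qed

text \<open>Method of conditional expectations for the potential that sums \<open>cosh\<close> over
  all constraints \<open>c\<close>. By the addition formula the potentials for the two choices of
  the next sign add up to at most \<open>2 * exp (t^2)\<close> times the old one, so one choice
  multiplies it by at most \<open>exp (t^2)\<close>.\<close>

lemma ex_signs_sum_cosh_le:
  fixes a :: "'c \<Rightarrow> nat \<Rightarrow> real" and n :: nat and t :: real
  assumes "finite C" and "\<And>c j. c \<in> C \<Longrightarrow> j < n \<Longrightarrow> \<bar>a c j\<bar> \<le> 1" and "0 \<le> t" "t \<le> 1"
  shows "\<exists>\<epsilon>. (\<forall>j. \<epsilon> j \<in> {-1, 1}) \<and>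
    (\<Sum>c\<in>C. cosh (t * (\<Sum>j<n. \<epsilon> j * a c j))) \<le> card C * exp (t\<^sup>2 * n)"
  using assms(2)
proof (induction n)
  case 0
  show ?case
    by (intro exI[of _ "\<lambda>_. 1"]) auto
next
  case (Suc n)
  then obtain \<epsilon> where \<epsilon>: "\<forall>j. \<epsilon> j \<in> {-1, 1}"
    "(\<Sum>c\<in>C. cosh (t * (\<Sum>j<n. \<epsilon> j * a c j))) \<le> card C * exp (t\<^sup>2 * n)"
    using less_SucI by blast
  define S where "S c = (\<Sum>j<n. \<epsilon> j * a c j)" for c
  have S: "(\<Sum>j<Suc n. (\<epsilon>(n := e)) j * a c j) = S c + e * a c n" for c e
    by (simp add: S_def)
  have "(\<Sum>c\<in>C. cosh (t * (S c + 1 * a c n))) + (\<Sum>c\<in>C. cosh (t * (S c + (-1) * a c n)))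
      = (\<Sum>c\<in>C. 2 * (cosh (t * S c) * cosh (t * a c n)))"
    by (simp add: sum.distrib[symmetric] algebra_simps cosh_add cosh_diff)
  also have "\<dots> \<le> (\<Sum>c\<in>C. 2 * (cosh (t * S c) * exp (t\<^sup>2)))"
  proof (intro sum_mono mult_left_mono)
    fix c assume c: "c \<in> C"
    have 1: "\<bar>t * a c n\<bar> \<le> t"
      using Suc.prems[of c n] c assms by (simp add: abs_mult mult_left_le)
    then have "cosh (t * a c n) \<le> exp ((t * a c n)\<^sup>2)"
      using assms by (intro cosh_le_exp_power2) auto
    also have "\<dots> \<le> exp (t\<^sup>2)"
      using 1 assms abs_le_square_iff[of "t * a c n" t] by simp
    finally show "cosh (t * a c n) \<le> exp (t\<^sup>2)" .
  qed auto
  also have "\<dots> = 2 * (exp (t\<^sup>2) * (\<Sum>c\<in>C. cosh (t * S c)))"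
    by (simp add: sum_distrib_left mult_ac)
  also have "\<dots> \<le> 2 * (exp (t\<^sup>2) * (card C * exp (t\<^sup>2 * n)))"
    using \<epsilon>(2) by (intro mult_left_mono) (auto simp: S_def)
  also have "\<dots> = 2 * (card C * exp (t\<^sup>2 * Suc n))"
    by (simp add: exp_add algebra_simps)
  finally consider "(\<Sum>c\<in>C. cosh (t * (S c + 1 * a c n))) \<le> card C * exp (t\<^sup>2 * Suc n)"
    | "(\<Sum>c\<in>C. cosh (t * (S c + (-1) * a c n))) \<le> card C * exp (t\<^sup>2 * Suc n)"
    by linarith
  then obtain e :: real where "e \<in> {-1, 1}"
    "(\<Sum>c\<in>C. cosh (t * (S c + e * a c n))) \<le> card C * exp (t\<^sup>2 * Suc n)"
    by cases blast+
  then show ?case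
    using \<epsilon>(1) S by (intro exI[of _ "\<epsilon>(n := e)"]) (auto simp del: sum.lessThan_Suc)
qed

text \<open>With \<open>t = 1 / sqrt n\<close> the potential stays below
  \<open>card C * exp 1\<close>, and each single summand is at least
  \<open>exp \<bar>t * S\<bar> / 2\<close>; taking logarithms bounds all the sums
  simultaneously.\<close>

lemma ex_signs_balanced:
  fixes a :: "'c \<Rightarrow> nat \<Rightarrow> real" and n :: nat
  assumes "finite C" and a: "\<And>c j. c \<in> C \<Longrightarrow> j < n \<Longrightarrow> \<bar>a c j\<bar> \<le> 1"
  shows "\<exists>\<epsilon>. (\<forall>j. \<epsilon> j \<in> {-1, 1}) \<and>
    (\<forall>c\<in>C. \<bar>\<Sum>j<n. \<epsilon> j * a c j\<bar> \<le> sqrt n * (ln (2 * card C) + 1))"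
proof (cases "n = 0")
  case True
  then show ?thesis
    by (intro exI[of _ "\<lambda>_. 1"]) auto
next
  case False
  define t where "t = 1 / sqrt n"
  have t: "0 < t" "t \<le> 1" "t\<^sup>2 * n = 1"
    using False by (auto simp: t_def power_divide)
  obtain \<epsilon> where \<epsilon>: "\<forall>j. \<epsilon> j \<in> {-1, 1}"
    "(\<Sum>c\<in>C. cosh (t * (\<Sum>j<n. \<epsilon> j * a c j))) \<le> card C * exp (t\<^sup>2 * n)"
    using ex_signs_sum_cosh_le[OF assms(1), of n a t] a t by auto
  have "\<bar>\<Sum>j<n. \<epsilon> j * a c j\<bar> \<le> sqrt n * (ln (2 * card C) + 1)" if c: "c \<in> C" for c
  proof -
    define S where "S = (\<Sum>j<n. \<epsilon> j * a c j)"
    have C: "card C > 0"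
      using c assms(1) card_gt_0_iff by blast
    have "exp \<bar>t * S\<bar> / 2 \<le> cosh \<bar>t * S\<bar>"
      by (simp add: cosh_field_def)
    also have "\<dots> = cosh (t * S)"
      by (simp add: abs_if)
    also have "\<dots> \<le> (\<Sum>c\<in>C. cosh (t * (\<Sum>j<n. \<epsilon> j * a c j)))"
      unfolding S_def using c assms(1)
      by (intro member_le_sum[where f = "\<lambda>c. cosh (t * (\<Sum>j<n. \<epsilon> j * a c j))"]) auto
    also have "\<dots> \<le> card C * exp 1"
      using \<epsilon>(2) t(3) by simp
    finally have "exp \<bar>t * S\<bar> \<le> (2 * card C) * exp 1"
      by simp
    also have "\<dots> = exp (ln (2 * card C) + 1)"
      using C by (simp add: exp_add)
    finally have "t * \<bar>S\<bar> \<le> ln (2 * card C) + 1"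
      using t by (simp add: abs_mult)
    then show ?thesis
      using False by (simp add: t_def S_def field_simps)
  qed
  then show ?thesis
    using \<epsilon>(1) by blast
qed

text \<open>Rows \<open>j\<close> and \<open>m + j\<close> form a pair, and a sign decides which of
  the two goes to \<open>\<sigma>\<close>. The difference of the two Gram sums is then a signed sum
  over \<open>j\<close>, balanced for all pairs of columns at once.\<close>

lemma ex_balanced_split:
  fixes u :: "nat \<Rightarrow> 'x \<Rightarrow> real" and m :: nat
  assumes "finite X" and u: "\<And>j x. j < 2 * m \<Longrightarrow> x \<in> X \<Longrightarrow> \<bar>u j x\<bar> \<le> 1"
  shows "\<exists>\<sigma> \<tau>. (\<forall>j. (\<sigma> j = j \<and> \<tau> j = m + j) \<or> (\<sigma> j = m + j \<and> \<tau> j = j)) \<and>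
    (\<forall>a\<in>X. \<forall>b\<in>X. \<bar>\<Sum>j<m. u (\<sigma> j) a * u (\<sigma> j) b - u (\<tau> j) a * u (\<tau> j) b\<bar>
       \<le> 2 * sqrt m * (ln (2 * (card X)\<^sup>2) + 1))"
proof -
  \<comment> \<open>The factor 1/2 brings the entries into [-1, 1]; it returns as the factor 2 in
    the bound.\<close>
  define f where "f = (\<lambda>(a, b) j. (u j a * u j b - u (m + j) a * u (m + j) b) / 2)"
  have "\<bar>f c j\<bar> \<le> 1" if cX: "c \<in> X \<times> X" and "j < m" for c j
  proof -
    obtain a b where c: "c = (a, b)" "a \<in> X" "b \<in> X"
      using cX by auto
    have "\<bar>u i a * u i b\<bar> \<le> 1" if "i < 2 * m" for i
      using u[OF that c(2)] u[OF that c(3)] by (simp add: abs_mult mult_le_one)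
    from this[of j] this[of "m + j"] that show ?thesis
      by (simp add: f_def c)
  qed
  then obtain \<epsilon> where \<epsilon>: "\<And>j. \<epsilon> j \<in> {-1, 1}"
    "\<And>c. c \<in> X \<times> X \<Longrightarrow> \<bar>\<Sum>j<m. \<epsilon> j * f c j\<bar> \<le> sqrt m * (ln (2 * card (X \<times> X)) + 1)"
    using ex_signs_balanced[of "X \<times> X" m f] assms(1) by blast
  define \<sigma> \<tau> where "\<sigma> j = (if \<epsilon> j = 1 then j else m + j)" and "\<tau> j = (if \<epsilon> j = 1 then m + j else j)" for j
  have "\<bar>\<Sum>j<m. u (\<sigma> j) a * u (\<sigma> j) b - u (\<tau> j) a * u (\<tau> j) b\<bar>
       \<le> 2 * sqrt m * (ln (2 * (card X)\<^sup>2) + 1)" if "a \<in> X" "b \<in> X" for a b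
  proof -
    have "u (\<sigma> j) a * u (\<sigma> j) b - u (\<tau> j) a * u (\<tau> j) b = 2 * (\<epsilon> j * f (a, b) j)" for j
      using \<epsilon>(1)[of j] by (auto simp: \<sigma>_def \<tau>_def f_def)
    then have "(\<Sum>j<m. u (\<sigma> j) a * u (\<sigma> j) b - u (\<tau> j) a * u (\<tau> j) b) = 2 * (\<Sum>j<m. \<epsilon> j * f (a, b) j)"
      by (simp add: sum_distrib_left)
    then show ?thesis
      using \<epsilon>(2)[of "(a, b)"] that by (simp add: abs_mult card_cartesian_product power2_eq_square)
  qed
  then show ?thesis
    by (intro exI[of _ \<sigma>] exI[of _ \<tau>]) (auto simp: \<sigma>_def \<tau>_def)
qed

section \<open>Hadamard matrices and the selection of rows\<close>

lemma sum_lessThan_double: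
  fixes f :: "nat \<Rightarrow> 'a::comm_monoid_add"
  shows "(\<Sum>j<2 * n. f j) = (\<Sum>j<n. f j) + (\<Sum>j<n. f (n + j))"
proof -
  have "{..<2 * n} = {..<n} \<union> {n..<n + n}"
    by auto
  then have "(\<Sum>j<2 * n. f j) = (\<Sum>j<n. f j) + (\<Sum>j\<in>{n..<n + n}. f j)"
    by (simp add: sum.union_disjoint ivl_disj_int)
  then show ?thesis
    using sum.shift_bounds_nat_ivl[of f 0 n n] by (simp add: lessThan_atLeast0 add.commute)
qed

text \<open>Sylvester's doubling: the next matrix consists of three copies of \<open>H\<close> and
  one of \<open>- H\<close> in the lower right corner.\<close>

lemma ex_hadamard_matrix:
  "\<exists>H :: nat \<Rightarrow> nat \<Rightarrow> real. (\<forall>i j. H i j \<in> {-1, 1}) \<and>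
    (\<forall>i<2 ^ k. \<forall>i'<2 ^ k. (\<Sum>j<2 ^ k. H i j * H i' j) = (if i = i' then 2 ^ k else 0))"
proof (induction k)
  case 0
  show ?case
    by (intro exI[of _ "\<lambda>_ _. 1"]) auto
next
  case (Suc k)
  then obtain H :: "nat \<Rightarrow> nat \<Rightarrow> real" where H: "\<forall>i j. H i j \<in> {-1, 1}"
    "\<And>i i'. i < 2 ^ k \<Longrightarrow> i' < 2 ^ k \<Longrightarrow> (\<Sum>j<2 ^ k. H i j * H i' j) = (if i = i' then 2 ^ k else 0)"
    by blast
  define N :: nat where "N = 2 ^ k"
  define G where "G i j = H (i mod N) (j mod N) * (if i \<ge> N \<and> j \<ge> N then -1 else 1)" for i j
  have "(\<Sum>j<2 * N. G i j * G i' j) = (if i = i' then 2 * 2 ^ k else 0)"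
    if i: "i < 2 * N" "i' < 2 * N" for i i'
  proof -
    have N: "N > 0" by (simp add: N_def)
    \<comment> \<open>\<open>s\<close> compares the signs of the two rows on the right half;
      \<open>1 + s\<close> is 0 for rows from different halves and 2 otherwise.\<close>
    define s where "s = (if i \<ge> N then -1 else 1 :: real) * (if i' \<ge> N then -1 else 1)"
    have "(\<Sum>j<2 * N. G i j * G i' j) =
        (\<Sum>j<N. H (i mod N) j * H (i' mod N) j) + (\<Sum>j<N. s * (H (i mod N) j * H (i' mod N) j))"
      unfolding sum_lessThan_double
      by (intro arg_cong2[where f = "(+)"] sum.cong) (auto simp: G_def s_def)
    also have "\<dots> = (1 + s) * (if i mod N = i' mod N then 2 ^ k else 0)"
      using H(2)[of "i mod N" "i' mod N"] N by (simp add: sum_distrib_left[symmetric] N_def distrib_right)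
    also have "\<dots> = (if i = i' then 2 * 2 ^ k else 0)"
    proof -
      have "i mod N = (if i \<ge> N then i - N else i)" "i' mod N = (if i' \<ge> N then i' - N else i')"
        using i by (auto simp: le_mod_geq)
      then show ?thesis
        using i by (auto simp: s_def)
    qed
    finally show ?thesis .
  qed
  moreover have "\<forall>i j. G i j \<in> {-1, 1}"
  proof (intro allI)
    fix i j
    show "G i j \<in> {-1, 1}"
      using H(1)[rule_format, of "i mod N" "j mod N"] by (auto simp: G_def)
  qed
  ultimately show ?case
    by (intro exI[of _ G]) (auto simp: N_def)
qed

text \<open>The rows of a Hadamard matrix are split evenly twice: first into \<open>P\<close> and
  \<open>R\<close>, then \<open>R\<close> into \<open>Q\<close> and a rest Q'. For the Gram sums, P
  - 2 Q = (P - R) - (Q - Q'), so both errors are those of balanced splits. Orthogonality is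
  inherited because the selected rows are distinct.\<close>

lemma ex_complementary_rows:
  assumes m_def: "m = (2 ^ k :: nat)"
  shows "\<exists>P Q :: nat \<Rightarrow> nat \<Rightarrow> real. (\<forall>j i. P j i \<in> {-1, 1}) \<and> (\<forall>j i. Q j i \<in> {-1, 1}) \<and>
    (\<forall>j<2 * m. \<forall>l<2 * m. (\<Sum>i<4 * m. P j i * P l i) = (if j = l then 4 * real m else 0)) \<and>
    (\<forall>j<m. \<forall>l<m. (\<Sum>i<4 * m. Q j i * Q l i) = (if j = l then 4 * real m else 0)) \<and>
    (\<forall>j<2 * m. \<forall>l<m. (\<Sum>i<4 * m. P j i * Q l i) = 0) \<and>
    (\<forall>a<4 * m. \<forall>b<4 * m. \<bar>(\<Sum>j<2 * m. P j a * P j b) - 2 * (\<Sum>j<m. Q j a * Q j b)\<bar>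
       \<le> 4 * sqrt (2 * real m) * (ln (32 * (real m)\<^sup>2) + 1))"
proof -
  obtain H :: "nat \<Rightarrow> nat \<Rightarrow> real" where H: "\<And>i j. H i j \<in> {-1, 1}" and
    "\<forall>i<2 ^ (k + 2). \<forall>i'<2 ^ (k + 2). (\<Sum>j<2 ^ (k + 2). H i j * H i' j) = (if i = i' then 2 ^ (k + 2) else 0)"
    using ex_hadamard_matrix[of "k + 2"] by blast
  then have orth: "(\<Sum>j<4 * m. H i j * H i' j) = (if i = i' then 4 * real m else 0)"
    if "i < 4 * m" "i' < 4 * m" for i i'
    using that by (simp add: m_def)
  have H1: "\<bar>H i j\<bar> \<le> 1" for i j
    using H[of i j] by auto
  \<comment> \<open>The number \<open>32 * m^2\<close> is \<open>2 * (card X)^2\<close> for the set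
    \<open>X\<close> of the \<open>4 * m\<close> columns.\<close>
  obtain \<sigma> \<tau> where st0: "(\<forall>j. (\<sigma> j = j \<and> \<tau> j = 2 * m + j) \<or> (\<sigma> j = 2 * m + j \<and> \<tau> j = j)) \<and>
    (\<forall>a\<in>{..<4 * m}. \<forall>b\<in>{..<4 * m}. \<bar>\<Sum>j<2 * m. H (\<sigma> j) a * H (\<sigma> j) b - H (\<tau> j) a * H (\<tau> j) b\<bar>
       \<le> 2 * sqrt (2 * real m) * (ln (32 * (real m)\<^sup>2) + 1))"
    using ex_balanced_split[of "{..<4 * m}" "2 * m" H, OF finite_lessThan H1, simplified]
    by (elim exE) (erule that)
  note st = conjunct1[OF st0] conjunct2[OF st0]
  define R where "R j = H (\<tau> j)" for j
  obtain \<sigma>' \<tau>' where st0': "(\<forall>j. (\<sigma>' j = j \<and> \<tau>' j = m + j) \<or> (\<sigma>' j = m + j \<and> \<tau>' j = j)) \<and>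
    (\<forall>a\<in>{..<4 * m}. \<forall>b\<in>{..<4 * m}. \<bar>\<Sum>j<m. R (\<sigma>' j) a * R (\<sigma>' j) b - R (\<tau>' j) a * R (\<tau>' j) b\<bar>
       \<le> 2 * sqrt m * (ln (32 * (real m)\<^sup>2) + 1))"
    using ex_balanced_split[of "{..<4 * m}" m R, OF finite_lessThan H1[of "\<tau> _", folded R_def], simplified]
    by (elim exE) (erule that)
  note st' = conjunct1[OF st0'] conjunct2[OF st0']
  define P Q where "P j = H (\<sigma> j)" and "Q j = R (\<sigma>' j)" for j
  have lt: "\<sigma> j < 4 * m" "\<tau> j < 4 * m" if "j < 2 * m" for j
    using st(1)[rule_format, of j] that by auto
  have lt': "\<sigma>' j < 2 * m" if "j < m" for j
    using st'(1)[rule_format, of j] that by auto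
  have aux: "(j \<noteq> l \<longrightarrow> x \<noteq> x' \<and> y \<noteq> y' \<and> x \<noteq> y') \<and> x \<noteq> y"
    if "x = j \<and> y = n + j \<or> x = n + j \<and> y = j" "x' = l \<and> y' = n + l \<or> x' = n + l \<and> y' = l" "j < n" "l < n"
    for x y x' y' j l n :: nat
    using that by auto
  have inj: "\<sigma> j = \<sigma> l \<longleftrightarrow> j = l" "\<tau> j = \<tau> l \<longleftrightarrow> j = l" "\<sigma> j \<noteq> \<tau> l" if "j < 2 * m" "l < 2 * m" for j l
    using aux[OF st(1)[rule_format, of j] st(1)[rule_format, of l] that] by metis+
  have inj': "\<sigma>' j = \<sigma>' l \<longleftrightarrow> j = l" if "j < m" "l < m" for j l
    using aux[OF st'(1)[rule_format, of j] st'(1)[rule_format, of l] that] by metis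
  have "\<bar>(\<Sum>j<2 * m. P j a * P j b) - 2 * (\<Sum>j<m. Q j a * Q j b)\<bar>
       \<le> 4 * sqrt (2 * real m) * (ln (32 * (real m)\<^sup>2) + 1)" if ab: "a < 4 * m" "b < 4 * m" for a b
  proof -
    let ?L = "ln (32 * (real m)\<^sup>2) + 1"
    have "m \<ge> 1" by (simp add: m_def)
    then have "1 \<le> (real m)\<^sup>2"
      by (intro one_le_power) auto
    then have L: "?L \<ge> 0"
      by (intro add_nonneg_nonneg ln_ge_zero) auto
    have split: "(\<Sum>j<m. R (\<sigma>' j) a * R (\<sigma>' j) b + R (\<tau>' j) a * R (\<tau>' j) b) = (\<Sum>j<2 * m. R j a * R j b)"
      unfolding sum_lessThan_double sum.distrib[symmetric]
    proof (intro sum.cong refl)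
      fix j
      show "R (\<sigma>' j) a * R (\<sigma>' j) b + R (\<tau>' j) a * R (\<tau>' j) b = R j a * R j b + R (m + j) a * R (m + j) b"
        using st'(1)[rule_format, of j] by (elim disjE conjE) simp_all
    qed
    have "(\<Sum>j<2 * m. P j a * P j b) - 2 * (\<Sum>j<m. Q j a * Q j b) =
       (\<Sum>j<2 * m. H (\<sigma> j) a * H (\<sigma> j) b - H (\<tau> j) a * H (\<tau> j) b)
       - (\<Sum>j<m. R (\<sigma>' j) a * R (\<sigma>' j) b - R (\<tau>' j) a * R (\<tau>' j) b)"
      using split by (simp add: sum_subtractf sum.distrib P_def Q_def R_def)
    also have "\<bar>\<dots>\<bar> \<le> 2 * sqrt (2 * real m) * ?L + 2 * sqrt m * ?L"
      using st(2) st'(2) ab by (intro abs_triangle_ineq4 [THEN order_trans] add_mono) auto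
    also have "\<dots> \<le> 2 * sqrt (2 * real m) * ?L + 2 * sqrt (2 * real m) * ?L"
      using L by (intro add_left_mono mult_right_mono) auto
    finally show ?thesis by simp
  qed
  moreover have "(\<Sum>i<4 * m. P j i * P l i) = (if j = l then 4 * real m else 0)" if "j < 2 * m" "l < 2 * m" for j l
    using orth[OF lt(1)[OF that(1)] lt(1)[OF that(2)]] inj(1)[OF that] by (simp add: P_def)
  moreover have "(\<Sum>i<4 * m. Q j i * Q l i) = (if j = l then 4 * real m else 0)" if "j < m" "l < m" for j l
    using orth[OF lt(2)[OF lt'[OF that(1)]] lt(2)[OF lt'[OF that(2)]]] inj(2)[OF lt'[OF that(1)] lt'[OF that(2)]]
      inj'[OF that] by (simp add: Q_def R_def)
  moreover have "(\<Sum>i<4 * m. P j i * Q l i) = 0" if "j < 2 * m" "l < m" for j l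
    using orth[OF lt(1)[OF that(1)] lt(2)[OF lt'[OF that(2)]]] inj(3)[OF that(1) lt'[OF that(2)]]
    by (simp add: P_def Q_def R_def)
  moreover have "\<forall>j i. P j i \<in> {-1, 1}" "\<forall>j i. Q j i \<in> {-1, 1}"
    using H by (auto simp: P_def Q_def R_def)
  ultimately show ?thesis
    by (intro exI[of _ P] exI[of _ Q]) auto
qed

section \<open>Dyadic blocks and orthonormal frames with flat Gram sums\<close>

definition block :: "nat \<Rightarrow> nat set" where
  "block k = {4 * 2 ^ k..<8 * 2 ^ k}"

lemma finite_block [simp]: "finite (block k)"
  by (simp add: block_def)

lemma sum_block:
  fixes f :: "nat \<Rightarrow> 'a::comm_monoid_add"
  shows "(\<Sum>i\<in>block k. f i) = (\<Sum>i<4 * 2 ^ k. f (4 * 2 ^ k + i))"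
proof -
  have "block k = {0 + 4 * 2 ^ k..<4 * 2 ^ k + 4 * 2 ^ k}"
    by (simp add: block_def)
  then show ?thesis
    using sum.shift_bounds_nat_ivl[of f 0 "4 * 2 ^ k" "4 * 2 ^ k"]
    by (simp add: lessThan_atLeast0 add.commute)
qed

lemma block_disjoint:
  assumes "i \<in> block k" "i \<in> block l"
  shows "k = l"
proof -
  have "k \<le> l" if "i \<in> block k" "i \<in> block l" for k l
  proof (rule ccontr)
    assume "\<not> k \<le> l"
    then have "(2::nat) ^ Suc l \<le> 2 ^ k"
      by (intro power_increasing) auto
    then show False
      using that by (auto simp: block_def)
  qed
  then show ?thesis
    using assms by (meson le_antisym)
qed

text \<open>Level \<open>k\<close> has \<open>2 * 2 ^ k\<close> vectors \<open>p k j\<close>, as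
  many as there are \<open>q (Suc k) j\<close> on the next level, so that the two families can be
  coupled index by index. Constant modulus of the entries makes the difference in
  \<open>diag_flat\<close> vanish for \<open>a = b\<close>; the two flatness bounds express square
  root cancellation up to a factor \<open>k + 1\<close>.\<close>

locale frames =
  fixes p q :: "nat \<Rightarrow> nat \<Rightarrow> nat \<Rightarrow> real"
  assumes p_outside: "i \<notin> block k \<Longrightarrow> p k j i = 0"
    and q_outside: "i \<notin> block k \<Longrightarrow> q k j i = 0"
    and p_square: "i \<in> block k \<Longrightarrow> p k j i * p k j i = 1 / (4 * 2 ^ k)"
    and q_square: "i \<in> block k \<Longrightarrow> q k j i * q k j i = 1 / (4 * 2 ^ k)"
    and p_orth: "j < 2 * 2 ^ k \<Longrightarrow> l < 2 * 2 ^ k \<Longrightarrow>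
      (\<Sum>i\<in>block k. p k j i * p k l i) = (if j = l then 1 else 0)"
    and q_orth: "j < 2 ^ k \<Longrightarrow> l < 2 ^ k \<Longrightarrow>
      (\<Sum>i\<in>block k. q k j i * q k l i) = (if j = l then 1 else 0)"
    and pq_orth: "j < 2 * 2 ^ k \<Longrightarrow> l < 2 ^ k \<Longrightarrow> (\<Sum>i\<in>block k. p k j i * q k l i) = 0"
    and diag_flat: "\<bar>(\<Sum>j<2 * 2 ^ k. p k j a * p k j b) - 2 * (\<Sum>j<2 ^ k. q k j a * q k j b)\<bar>
      \<le> 9 * (real k + 1) / sqrt (2 ^ k)"
    and off_diag_flat: "\<bar>\<Sum>j<2 * 2 ^ k. p k j a * q (Suc k) j b\<bar> \<le> 9 * (real k + 1) / sqrt (2 ^ k)"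

text \<open>Each level takes its rows from its own Hadamard matrix. The extra signs
  \<open>\<epsilon>\<close> on the \<open>p k j\<close> change neither orthonormality nor the
  products \<open>p k j a * p k j b\<close>, so they are free to balance the mixed sums with the
  next level.\<close>

lemma ex_frames: "\<exists>p q. frames p q"
proof -
  define m where "m k = (2 ^ k :: nat)" for k
  have m_Suc: "m (Suc k) = 2 * m k" for k by (simp add: m_def)
  have m_pos: "0 < m k" for k by (simp add: m_def)
  define good where "good k P Q \<longleftrightarrow> (\<forall>j i. P j i \<in> {-1, 1}) \<and> (\<forall>j i. Q j i \<in> {-1, 1}) \<and>
    (\<forall>j<2 * m k. \<forall>l<2 * m k. (\<Sum>i<4 * m k. P j i * P l i) = (if j = l then 4 * real (m k) else 0)) \<and>
    (\<forall>j<m k. \<forall>l<m k. (\<Sum>i<4 * m k. Q j i * Q l i) = (if j = l then 4 * real (m k) else 0)) \<and>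
    (\<forall>j<2 * m k. \<forall>l<m k. (\<Sum>i<4 * m k. P j i * Q l i) = 0) \<and>
    (\<forall>a<4 * m k. \<forall>b<4 * m k. \<bar>(\<Sum>j<2 * m k. P j a * P j b) - 2 * (\<Sum>j<m k. Q j a * Q j b)\<bar>
       \<le> 4 * sqrt (2 * real (m k)) * (ln (32 * (real (m k))\<^sup>2) + 1))"
    for k and P Q :: "nat \<Rightarrow> nat \<Rightarrow> real"
  have "\<exists>P Q. good k P Q" for k
    unfolding good_def by (rule ex_complementary_rows[OF m_def])
  then obtain P Q where "\<And>k. good k (P k) (Q k)"
    by metis
  note PQ = this[unfolded good_def]
  have P1: "P k j i \<in> {-1, 1}" and Q1: "Q k j i \<in> {-1, 1}" for k j i
    using PQ by blast+
  define balanced where "balanced k \<epsilon> \<longleftrightarrow> (\<forall>j. \<epsilon> j \<in> {-1, 1}) \<and> (\<forall>c\<in>{..<4 * m k} \<times> {..<8 * m k}.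
     \<bar>\<Sum>j<2 * m k. \<epsilon> j * (P k j (fst c) * Q (Suc k) j (snd c))\<bar>
     \<le> sqrt (2 * m k) * (ln (2 * card ({..<4 * m k} \<times> {..<8 * m k})) + 1))" for k and \<epsilon> :: "nat \<Rightarrow> real"
  have "\<exists>\<epsilon>. balanced k \<epsilon>" for k
    unfolding balanced_def
  proof (rule ex_signs_balanced)
    show "\<bar>P k j (fst c) * Q (Suc k) j (snd c)\<bar> \<le> 1" for c j
      using P1[of k j "fst c"] Q1[of "Suc k" j "snd c"] by auto
  qed auto
  then obtain \<epsilon> where \<epsilon>0: "\<And>k. balanced k (\<epsilon> k)"
    by metis
  note \<epsilon> = conjunct1[OF \<epsilon>0[unfolded balanced_def], rule_format] conjunct2[OF \<epsilon>0[unfolded balanced_def], rule_format]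
  define p q where "p k j i = (if i \<in> block k then \<epsilon> k j * P k j (i - 4 * m k) / sqrt (4 * m k) else 0)"
    and "q k j i = (if i \<in> block k then Q k j (i - 4 * m k) / sqrt (4 * m k) else 0)" for k j i
  have \<epsilon>\<epsilon>: "\<epsilon> k j * \<epsilon> k j = 1" for k j
    using \<epsilon>(1)[of k j] by auto
  have block: "block k = {4 * m k..<8 * m k}" for k
    by (simp add: block_def m_def)
  have sum_blk: "(\<Sum>i\<in>block k. f i) = (\<Sum>i<4 * m k. f (4 * m k + i))" for f :: "nat \<Rightarrow> real" and k
    by (simp add: sum_block m_def)
  \<comment> \<open>The logarithms in the balancing bounds grow at most linearly in
    \<open>k\<close>, since \<open>ln 2 < 1\<close>.\<close>
  have ln_bound: "ln (x * 4 ^ k) \<le> y + 2 * k" if "x \<le> 2 ^ y" "x > 0" for x :: real and y k :: nat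
  proof -
    have "ln (x * 4 ^ k) \<le> ln (2 ^ y * 4 ^ k)"
      using that by simp
    also have "2 ^ y * 4 ^ k = (2 :: real) ^ (y + 2 * k)"
      by (simp add: power_add power_mult)
    also have "ln \<dots> = (y + 2 * k) * ln (2 :: real)"
      by (subst ln_realpow) auto
    also have "\<dots> \<le> real (y + 2 * k) * 1"
      using ln_2_less_1 by (intro mult_left_mono) auto
    finally show ?thesis by simp
  qed
  have m_square: "real (m k) * real (m k) = 4 ^ k" for k
    by (simp add: m_def power_mult_distrib[symmetric])
  have sqrt_m: "sqrt (m k) * sqrt (m k) = m k" "sqrt (m k) > 0" for k
    using m_pos[of k] by auto
  have cancel: "x * sqrt (m k) / (y * m k) = x / y / sqrt (m k)" for x y :: real and k
  proof -
    have "x * r / (y * (r * r)) = x / y / r" if "r > 0" for r :: real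
      using that by simp
    from this[OF sqrt_m(2)[of k]] show ?thesis
      by (simp only: sqrt_m(1))
  qed
  have s2: "sqrt 2 \<le> 3 / 2"
    by (rule real_le_lsqrt) (auto simp: power2_eq_square)
  have "frames p q"
  proof
    fix k j i
    show "i \<notin> block k \<Longrightarrow> p k j i = 0" "i \<notin> block k \<Longrightarrow> q k j i = 0"
      by (auto simp: p_def q_def)
    show "i \<in> block k \<Longrightarrow> p k j i * p k j i = 1 / (4 * 2 ^ k)"
      using P1[of k j "i - 4 * m k"] \<epsilon>(1)[of k j] by (auto simp: p_def m_def)
    show "i \<in> block k \<Longrightarrow> q k j i * q k j i = 1 / (4 * 2 ^ k)"
      using Q1[of k j "i - 4 * m k"] by (auto simp: q_def m_def)
  next
    fix k j l :: nat
    assume j: "j < 2 * 2 ^ k" and l: "l < 2 * 2 ^ k"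
    have "(\<Sum>i\<in>block k. p k j i * p k l i) = \<epsilon> k j * \<epsilon> k l / (4 * m k) * (\<Sum>i<4 * m k. P k j i * P k l i)"
      unfolding sum_blk sum_distrib_left by (intro sum.cong) (auto simp: p_def block)
    then show "(\<Sum>i\<in>block k. p k j i * p k l i) = (if j = l then 1 else 0)"
      using PQ[of k] j l m_pos[of k] by (auto simp: \<epsilon>\<epsilon> m_def)
  next
    fix k j l :: nat
    assume j: "j < 2 ^ k" and l: "l < 2 ^ k"
    have "(\<Sum>i\<in>block k. q k j i * q k l i) = 1 / (4 * m k) * (\<Sum>i<4 * m k. Q k j i * Q k l i)"
      unfolding sum_blk sum_distrib_left by (intro sum.cong) (auto simp: q_def block)
    then show "(\<Sum>i\<in>block k. q k j i * q k l i) = (if j = l then 1 else 0)"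
      using PQ[of k] j l m_pos[of k] by (auto simp: m_def)
  next
    fix k j l :: nat
    assume j: "j < 2 * 2 ^ k" and l: "l < 2 ^ k"
    have "(\<Sum>i\<in>block k. p k j i * q k l i) = \<epsilon> k j / (4 * m k) * (\<Sum>i<4 * m k. P k j i * Q k l i)"
      unfolding sum_blk sum_distrib_left by (intro sum.cong) (auto simp: p_def q_def block)
    then show "(\<Sum>i\<in>block k. p k j i * q k l i) = 0"
      using PQ[of k] j l by (auto simp: m_def)
  next
    fix k a b :: nat
    have nonneg: "0 \<le> 9 * (real k + 1) / sqrt (2 ^ k)"
      by simp
    show "\<bar>(\<Sum>j<2 * 2 ^ k. p k j a * p k j b) - 2 * (\<Sum>j<2 ^ k. q k j a * q k j b)\<bar> \<le> 9 * (real k + 1) / sqrt (2 ^ k)"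
    proof (cases "a \<in> block k \<and> b \<in> block k")
      case True
      define a' b' where "a' = a - 4 * m k" and "b' = b - 4 * m k"
      have ab: "a' < 4 * m k" "b' < 4 * m k"
        using True by (auto simp: a'_def b'_def block)
      have "p k j a * p k j b = (\<epsilon> k j * \<epsilon> k j) * (P k j a' * P k j b') / (sqrt (4 * m k) * sqrt (4 * m k))" for j
        using True by (simp add: p_def a'_def b'_def)
      then have pp: "p k j a * p k j b = P k j a' * P k j b' / (4 * m k)" for j
        by (simp add: \<epsilon>\<epsilon>)
      have "q k j a * q k j b = Q k j a' * Q k j b' / (sqrt (4 * m k) * sqrt (4 * m k))" for j
        using True by (simp add: q_def a'_def b'_def)
      then have qq: "q k j a * q k j b = Q k j a' * Q k j b' / (4 * m k)" for j
        by simp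
      have "\<bar>(\<Sum>j<2 * 2 ^ k. p k j a * p k j b) - 2 * (\<Sum>j<2 ^ k. q k j a * q k j b)\<bar> =
        \<bar>((\<Sum>j<2 * m k. P k j a' * P k j b') - 2 * (\<Sum>j<m k. Q k j a' * Q k j b')) / (4 * m k)\<bar>"
        unfolding pp qq sum_divide_distrib[symmetric] by (simp add: diff_divide_distrib m_def)
      also have "\<dots> = \<bar>(\<Sum>j<2 * m k. P k j a' * P k j b') - 2 * (\<Sum>j<m k. Q k j a' * Q k j b')\<bar> / (4 * m k)"
        by simp
      also have "\<dots> \<le> 4 * sqrt (2 * real (m k)) * (ln (32 * (real (m k))\<^sup>2) + 1) / (4 * m k)"
        using PQ[of k] ab by (intro divide_right_mono) auto
      also have "\<dots> = sqrt 2 * (ln (32 * 4 ^ k) + 1) / sqrt (m k)"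
      proof -
        define L :: real where "L = ln (32 * 4 ^ k) + 1"
        have "ln (32 * (real (m k))\<^sup>2) + 1 = L"
          by (simp add: L_def power2_eq_square m_square)
        then show ?thesis
          using cancel[where k = k and x = "4 * (sqrt 2 * L)" and y = 4]
          unfolding L_def[symmetric] by (simp add: real_sqrt_mult mult_ac)
      qed
      also have "\<dots> \<le> 9 * (real k + 1) / sqrt (m k)"
      proof (intro divide_right_mono)
        have "0 \<le> ln (32 * 4 ^ k :: real)"
          using one_le_power[of "4::real" k] by (intro ln_ge_zero) linarith
        \<comment> \<open>The constant 9 of \<open>frames\<close> arises here:
          \<open>32 = 2 ^ 5\<close> and \<open>sqrt 2 \<le> 3 / 2\<close> give
          \<open>3 / 2 * (2 * k + 6)\<close>, which is at most \<open>9 * (k + 1)\<close>.\<close>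
        then have "sqrt 2 * (ln (32 * 4 ^ k) + 1) \<le> 3 / 2 * ((5 + 2 * k) + 1)"
          using ln_bound[of 32 5 k] s2
          by (intro mult_mono) auto
        then show "sqrt 2 * (ln (32 * 4 ^ k) + 1) \<le> 9 * (real k + 1)"
          by simp
      qed auto
      finally show ?thesis by (simp add: m_def)
    next
      case False
      then have "(\<Sum>j<2 * 2 ^ k. p k j a * p k j b) = 0" "(\<Sum>j<2 ^ k. q k j a * q k j b) = 0"
        by (auto simp: p_def q_def)
      then show ?thesis
        using nonneg by simp
    qed
    show "\<bar>\<Sum>j<2 * 2 ^ k. p k j a * q (Suc k) j b\<bar> \<le> 9 * (real k + 1) / sqrt (2 ^ k)"
    proof (cases "a \<in> block k \<and> b \<in> block (Suc k)")
      case True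
      define a' b' where "a' = a - 4 * m k" and "b' = b - 4 * m (Suc k)"
      have ab: "(a', b') \<in> {..<4 * m k} \<times> {..<8 * m k}"
        using True by (auto simp: a'_def b'_def block m_Suc)
      have r: "sqrt (4 * m k) * sqrt (4 * m (Suc k)) = 4 * sqrt 2 * m k"
      proof -
        have "4 * m (Suc k) = (2 * (4 * m k))"
          by (simp add: m_Suc)
        then have "sqrt (4 * m k) * sqrt (4 * m (Suc k)) = sqrt 2 * (sqrt (4 * m k) * sqrt (4 * m k))"
          by (simp only: of_nat_mult real_sqrt_mult) simp
        then show ?thesis by simp
      qed
      have "(\<Sum>j<2 * 2 ^ k. p k j a * q (Suc k) j b) =
        (\<Sum>j<2 * m k. \<epsilon> k j * (P k j a' * Q (Suc k) j b') / (sqrt (4 * m k) * sqrt (4 * m (Suc k))))"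
        using True by (intro sum.cong) (auto simp: p_def q_def a'_def b'_def m_def)
      then have "\<bar>\<Sum>j<2 * 2 ^ k. p k j a * q (Suc k) j b\<bar> =
        \<bar>\<Sum>j<2 * m k. \<epsilon> k j * (P k j a' * Q (Suc k) j b')\<bar> / (4 * sqrt 2 * m k)"
        unfolding r by (simp add: sum_divide_distrib[symmetric])
      also have "\<dots> \<le> sqrt (2 * m k) * (ln (2 * card ({..<4 * m k} \<times> {..<8 * m k})) + 1) / (4 * sqrt 2 * m k)"
        using \<epsilon>(2)[OF ab] by (intro divide_right_mono) auto
      also have "\<dots> = (ln (64 * 4 ^ k) + 1) / 4 / sqrt (m k)"
      proof -
        define L :: real where "L = ln (64 * 4 ^ k) + 1"
        have "ln (2 * card ({..<4 * m k} \<times> {..<8 * m k})) + 1 = L"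
          by (simp add: L_def card_cartesian_product m_square mult_ac)
        then show ?thesis
          using cancel[where k = k and x = "sqrt 2 * L" and y = "4 * sqrt 2"]
          unfolding L_def[symmetric] by (simp add: real_sqrt_mult mult_ac)
      qed
      also have "\<dots> \<le> 9 * (real k + 1) / sqrt (m k)"
        using ln_bound[of 64 6 k] by (intro divide_right_mono) auto
      finally show ?thesis by (simp add: m_def)
    next
      case False
      then have "(\<Sum>j<2 * 2 ^ k. p k j a * q (Suc k) j b) = 0"
        by (auto simp: p_def q_def)
      then show ?thesis
        using nonneg by simp
    qed
  qed
  then show ?thesis by blast
qed

subsection \<open>The nilpotent matrix\<close>

context frames
begin

lemma sum_lessThan_block:
  fixes f :: "nat \<Rightarrow> real"
  assumes "8 * 2 ^ k \<le> n" and "\<And>i. i \<notin> block k \<Longrightarrow> f i = 0"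
  shows "(\<Sum>i<n. f i) = (\<Sum>i\<in>block k. f i)"
  using assms by (intro sum.mono_neutral_right) (auto simp: block_def)

lemma dot_p_p:
  assumes "8 * 2 ^ k \<le> n" "j < 2 * 2 ^ k" "j' < 2 * 2 ^ k'"
  shows "(\<Sum>i<n. p k j i * p k' j' i) = (if k = k' \<and> j = j' then 1 else 0)"
proof (cases "k = k'")
  case True
  then show ?thesis
    using assms p_orth p_outside by (subst sum_lessThan_block[of k]) auto
next
  case False
  then have "p k j i * p k' j' i = 0" for i
    using p_outside[of i k j] p_outside[of i k' j'] block_disjoint[of i k k'] by auto
  then show ?thesis
    using False by (auto intro!: sum.neutral)
qed

lemma dot_q_q:
  assumes "8 * 2 ^ k \<le> n" "j < 2 ^ k" "j' < 2 ^ k'"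
  shows "(\<Sum>i<n. q k j i * q k' j' i) = (if k = k' \<and> j = j' then 1 else 0)"
proof (cases "k = k'")
  case True
  then show ?thesis
    using assms q_orth q_outside by (subst sum_lessThan_block[of k]) auto
next
  case False
  then have "q k j i * q k' j' i = 0" for i
    using q_outside[of i k j] q_outside[of i k' j'] block_disjoint[of i k k'] by auto
  then show ?thesis
    using False by (auto intro!: sum.neutral)
qed

lemma dot_p_q:
  assumes "8 * 2 ^ k \<le> n" "j < 2 * 2 ^ k" "j' < 2 ^ k'"
  shows "(\<Sum>i<n. p k j i * q k' j' i) = 0"
proof (cases "k = k'")
  case True
  then show ?thesis
    using assms pq_orth p_outside by (subst sum_lessThan_block[of k]) auto
next
  case False
  then have "p k j i * q k' j' i = 0" for i
    using p_outside[of i k j] q_outside[of i k' j'] block_disjoint[of i k k'] by auto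
  then show ?thesis
    by (auto intro!: sum.neutral)
qed

lemma dot_q_p:
  assumes "8 * 2 ^ k \<le> n" "j < 2 ^ k" "j' < 2 * 2 ^ k'"
  shows "(\<Sum>i<n. q k j i * p k' j' i) = 0"
proof (cases "k = k'")
  case True
  then show ?thesis
    using dot_p_q[of k' n j' j k] assms by (simp add: mult.commute)
next
  case False
  then have "q k j i * p k' j' i = 0" for i
    using q_outside[of i k j] p_outside[of i k' j'] block_disjoint[of i k k'] by auto
  then show ?thesis
    by (auto intro!: sum.neutral)
qed

text \<open>The factor \<open>k + 1\<close> cancels in the scalar products of \<open>w\<close> with \<open>z\<close>, hence changes neither
  nilpotency nor trace, but it makes the off-diagonal blocks too large for the exponent \<open>r\<close>.\<close>

definition z :: "nat \<Rightarrow> nat \<Rightarrow> nat \<Rightarrow> real" where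
  "z k j i = (real k + 1) * p k j i + q (Suc k) j i"

definition w :: "nat \<Rightarrow> nat \<Rightarrow> nat \<Rightarrow> real" where
  "w k j i = p k j i / (real k + 1) - q (Suc k) j i"

text \<open>Block \<open>k\<close> starts at \<open>4 * 2 ^ k > k\<close>, so
  \<open>z k j i = 0\<close> for \<open>k \<ge> i\<close>. Stopping at \<open>i\<close> thus
  replaces the series over all levels by a finite sum.\<close>

definition A :: "nat \<Rightarrow> nat \<Rightarrow> real" where
  "A i l = (\<Sum>k<i. (\<Sum>j<2 * 2 ^ k. z k j i * w k j l) / 2 ^ Suc k)"

lemma z_support: "z k j i \<noteq> 0 \<Longrightarrow> 4 * 2 ^ k \<le> i \<and> i < 16 * 2 ^ k"
  using p_outside[of i k j] q_outside[of i "Suc k" j] by (auto simp: z_def block_def) force+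

lemma w_support: "w k j i \<noteq> 0 \<Longrightarrow> 4 * 2 ^ k \<le> i \<and> i < 16 * 2 ^ k"
  using p_outside[of i k j] q_outside[of i "Suc k" j] by (auto simp: w_def block_def) force+

lemma less_four_power: "k < 4 * 2 ^ k"
proof -
  have "k < 2 ^ k"
    by (rule less_exp)
  then show ?thesis by linarith
qed

lemma z_eq_0: "i \<le> k \<Longrightarrow> z k j i = 0"
  using z_support[of k j i] less_four_power[of k] by linarith

lemma A_eq:
  assumes "i \<le> n"
  shows "A i l = (\<Sum>k<n. (\<Sum>j<2 * 2 ^ k. z k j i * w k j l) / 2 ^ Suc k)"
  unfolding A_def using assms z_eq_0 by (intro sum.mono_neutral_left) auto

text \<open>\<open>z k j\<close> and \<open>w k j\<close> live on the window from
  \<open>4 * 2 ^ k\<close> to \<open>16 * 2 ^ k\<close>, whose end points have ratio 4. Hence rows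
  and columns of \<open>A\<close> are finite, and matrix products are finite sums.\<close>

lemma A_support:
  assumes "A i l \<noteq> 0"
  shows "l < 4 * i \<and> i < 4 * l"
proof -
  obtain k where "(\<Sum>j<2 * 2 ^ k. z k j i * w k j l) / 2 ^ Suc k \<noteq> 0"
    using assms unfolding A_def by (metis (no_types, lifting) sum.neutral)
  then have "(\<Sum>j<2 * 2 ^ k. z k j i * w k j l) \<noteq> 0"
    by simp
  then obtain j where "z k j i * w k j l \<noteq> 0"
    by (metis (no_types, lifting) sum.neutral)
  then show ?thesis
    using z_support[of k j i] w_support[of k j l] by auto
qed

text \<open>Only the products of \<open>p\<close> with \<open>p\<close> and of \<open>q\<close> with
  \<open>q\<close> can survive, and both only for equal level and index, where they contribute
  \<open>(k' + 1) / (k + 1) = 1\<close> and \<open>- 1\<close>.\<close>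

lemma dot_w_z:
  assumes n: "16 * 2 ^ k \<le> n" and j: "j < 2 * 2 ^ k" "j' < 2 * 2 ^ k'"
  shows "(\<Sum>i<n. w k j i * z k' j' i) = 0"
proof -
  have "(\<Sum>i<n. w k j i * z k' j' i) =
      (\<Sum>i<n. (real k' + 1) / (real k + 1) * (p k j i * p k' j' i))
      + (\<Sum>i<n. 1 / (real k + 1) * (p k j i * q (Suc k') j' i))
      - (\<Sum>i<n. (real k' + 1) * (q (Suc k) j i * p k' j' i))
      - (\<Sum>i<n. q (Suc k) j i * q (Suc k') j' i)"
    unfolding sum.distrib[symmetric] sum_subtractf[symmetric]
    by (intro sum.cong) (auto simp: w_def z_def algebra_simps add_divide_distrib)
  then show ?thesis
    unfolding sum_distrib_left[symmetric]
    using dot_p_p[of k n j j' k'] dot_p_q[of k n j j' "Suc k'"] dot_q_p[of "Suc k" n j j' k']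
      dot_q_q[of "Suc k" n j j' "Suc k'"] n j
    by simp
qed

text \<open>After expanding both factors, every summand contains a scalar product of some
  \<open>w\<close> with some \<open>z\<close>.\<close>

lemma A_square: "(\<Sum>l<4 * i. A i l * A l m) = 0"
proof -
  have "(\<Sum>l<4 * i. z k j i * w k j l * A l m) = 0" if j: "j < 2 * 2 ^ k" for k j
  proof (cases "z k j i = 0")
    case False
    \<comment> \<open>A row index with \<open>z k j i \<noteq> 0\<close> is at least
      \<open>4 * 2 ^ k\<close>, so the range \<open>l < 4 * i\<close> covers the support of
      \<open>w k j\<close> and the sum is the full scalar product.\<close>
    then have n: "16 * 2 ^ k \<le> 4 * i"
      using z_support by auto
    have "(\<Sum>l<4 * i. z k j i * w k j l * A l m) =
      (\<Sum>l<4 * i. \<Sum>k'<4 * i. \<Sum>j'<2 * 2 ^ k'. (z k j i * w k' j' m / 2 ^ Suc k') * (w k j l * z k' j' l))"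
      by (intro sum.cong refl, subst A_eq[where n = "4 * i"])
        (auto simp: sum_distrib_left sum_divide_distrib mult_ac)
    also have "\<dots> = (\<Sum>k'<4 * i. \<Sum>l<4 * i. \<Sum>j'<2 * 2 ^ k'. (z k j i * w k' j' m / 2 ^ Suc k') * (w k j l * z k' j' l))"
      by (rule sum.swap)
    also have "\<dots> = (\<Sum>k'<4 * i. \<Sum>j'<2 * 2 ^ k'. \<Sum>l<4 * i. (z k j i * w k' j' m / 2 ^ Suc k') * (w k j l * z k' j' l))"
      by (intro sum.cong refl sum.swap)
    also have "\<dots> = 0"
      unfolding sum_distrib_left[symmetric] using dot_w_z[OF n j]
      by (intro sum.neutral ballI) simp
    finally show ?thesis .
  qed auto
  note * = this
  have "(\<Sum>l<4 * i. A i l * A l m) =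
     (\<Sum>l<4 * i. \<Sum>k<i. \<Sum>j<2 * 2 ^ k. 1 / 2 ^ Suc k * (z k j i * w k j l * A l m))"
    unfolding A_def[of i] by (simp add: sum_distrib_right sum_divide_distrib)
  also have "\<dots> = (\<Sum>k<i. \<Sum>l<4 * i. \<Sum>j<2 * 2 ^ k. 1 / 2 ^ Suc k * (z k j i * w k j l * A l m))"
    by (rule sum.swap)
  also have "\<dots> = (\<Sum>k<i. \<Sum>j<2 * 2 ^ k. \<Sum>l<4 * i. 1 / 2 ^ Suc k * (z k j i * w k j l * A l m))"
    by (intro sum.cong refl sum.swap)
  also have "\<dots> = 0"
    unfolding sum_distrib_left[symmetric] using * by (intro sum.neutral ballI) simp
  finally show ?thesis .
qed

section \<open>Telescoped form, trace and decay of the entries\<close>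

definition D :: "nat \<Rightarrow> nat \<Rightarrow> nat \<Rightarrow> real" where
  "D k i l = (\<Sum>j<2 * 2 ^ k. p k j i * p k j l) - 2 * (\<Sum>j<2 ^ k. q k j i * q k j l)"

definition R :: "nat \<Rightarrow> nat \<Rightarrow> nat \<Rightarrow> real" where
  "R k i l = (\<Sum>j<2 * 2 ^ k. p k j i * q (Suc k) j l)"

text \<open>With weight \<open>1 / 2 ^ Suc k\<close> on level \<open>k\<close>, the diagonal parts that two consecutive
  levels contribute to a block combine to a multiple of \<open>D\<close>, which vanishes on the diagonal and
  is flat off it; only \<open>q 0 0\<close> remains and carries the trace.\<close>

lemma A_eq_telescoped:
  assumes "i \<le> n"
  shows "A i l = q 0 0 i * q 0 0 l +
    (\<Sum>k<n. (D k i l - (real k + 1) * R k i l + R k l i / (real k + 1)) / 2 ^ Suc k)"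
proof -
  define S where "S k = (\<Sum>j<2 ^ k. q k j i * q k j l)" for k
  have "(\<Sum>j<2 * 2 ^ k. z k j i * w k j l) =
     D k i l + 2 * S k - S (Suc k) - (real k + 1) * R k i l + R k l i / (real k + 1)" for k
  proof -
    have "(\<Sum>j<2 * 2 ^ k. z k j i * w k j l) =
      (\<Sum>j<2 * 2 ^ k. p k j i * p k j l - q (Suc k) j i * q (Suc k) j l
        - (real k + 1) * (p k j i * q (Suc k) j l) + (p k j l * q (Suc k) j i) / (real k + 1))"
      by (intro sum.cong refl) (simp add: z_def w_def field_simps)
    then show ?thesis
      by (simp add: D_def R_def S_def sum.distrib sum_subtractf sum_distrib_left sum_divide_distrib)
  qed
  then have "A i l = (\<Sum>k<n. (D k i l - (real k + 1) * R k i l + R k l i / (real k + 1)) / 2 ^ Suc k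
      + (S k / 2 ^ k - S (Suc k) / 2 ^ Suc k))"
    unfolding A_eq[OF assms] by (intro sum.cong refl) (simp add: add_divide_distrib diff_divide_distrib)
  also have "\<dots> = (\<Sum>k<n. (D k i l - (real k + 1) * R k i l + R k l i / (real k + 1)) / 2 ^ Suc k)
      + (S 0 / 2 ^ 0 - S n / 2 ^ n)"
    unfolding sum.distrib using sum_lessThan_telescope'[of "\<lambda>k. S k / 2 ^ k" n] by simp
  \<comment> \<open>The upper boundary term vanishes because \<open>i \<le> n\<close> lies before
    block \<open>n\<close>.\<close>
  also have "S n = 0"
  proof -
    have "i \<notin> block n"
      using assms less_four_power[of n] by (auto simp: block_def)
    then show ?thesis
      by (simp add: S_def q_outside)
  qed
  finally show ?thesis
    by (simp add: S_def)
qed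

text \<open>On the diagonal \<open>D\<close> vanishes because all entries of a level have the same
  modulus, and \<open>R\<close> because \<open>p k\<close> and \<open>q (Suc k)\<close> have
  disjoint supports. What remains is 1/4 at each of the four coordinates of
  \<open>block 0\<close>.\<close>

lemma A_diag_sums: "(\<lambda>i. A i i) sums 1"
proof -
  have D: "D k i i = 0" for k i
  proof (cases "i \<in> block k")
    case True
    then show ?thesis
      by (simp add: D_def p_square q_square)
  qed (simp add: D_def p_outside q_outside)
  have R: "R k i i = 0" for k i
    unfolding R_def using p_outside[of i k] q_outside[of i "Suc k"] block_disjoint[of i k "Suc k"]
    by (intro sum.neutral ballI) force
  have "A i i = q 0 0 i * q 0 0 i" for i
    using A_eq_telescoped[of i i i] by (simp add: D R)
  then have A: "A i i = (if i \<in> block 0 then 1 / 4 else 0)" for i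
    using q_square[of i 0 0] q_outside[of i 0 0] by auto
  have "(\<lambda>i. A i i) sums (\<Sum>i\<in>block 0. A i i)"
    by (rule sums_finite) (auto simp: A)
  also have "(\<Sum>i\<in>block 0. A i i) = 1"
    by (simp add: A block_def)
  finally show ?thesis .
qed

text \<open>Level \<open>k\<close> contributes at most a multiple of
  \<open>(k + 1)^2 * 2 powr (- 3 / 2 * k)\<close>, and only where both indices are comparable to
  \<open>2 ^ k\<close>. Every exponent below 3/2 leaves room for the factor
  \<open>(k + 1)^2\<close>. At index 0 the bound says that the entry is 0, since
  \<open>0 powr y = 0\<close>.\<close>

lemma A_bound:
  assumes a: "0 \<le> a" "a < 3 / 2"
  shows "\<exists>C\<ge>0. \<forall>i l. \<bar>A i l\<bar> \<le> C * real i powr - a \<and> \<bar>A i l\<bar> \<le> C * real l powr - a"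
proof -
  \<comment> \<open>Up to a constant, \<open>g k\<close> is the size of level \<open>k\<close> after
    the factor \<open>(2 powr - k) powr a\<close> has been split off.\<close>
  define g :: "nat \<Rightarrow> real" where "g k = (real k + 1)\<^sup>2 * 2 powr ((a - 3 / 2) * k)" for k
  have "summable g"
  proof (rule summable_comparison_test_bigo)
    show "summable (\<lambda>k. norm ((2 powr ((a - 3 / 2) / 2)) ^ k :: real))"
      using a powr_less_mono[of "(a - 3 / 2) / 2" 0 2] by (simp add: summable_norm_cancel norm_power)
    have e: "(2 powr ((a - 3 / 2) / 2)) ^ k = (2 :: real) powr ((a - 3 / 2) / 2 * k)" for k
      by (simp add: powr_powr powr_realpow[symmetric])
    define c where "c = 3 / 2 - a"
    have c: "c > 0"
      using a by (simp add: c_def)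
    have "(\<lambda>k. (real k + 1)\<^sup>2 * 2 powr (- c * k)) \<in> O(\<lambda>k. 2 powr (- c / 2 * real k))"
      using c by real_asymp
    moreover have "a - 3 / 2 = - c"
      by (simp add: c_def)
    ultimately show "g \<in> O(\<lambda>k. (2 powr ((a - 3 / 2) / 2)) ^ k)"
      unfolding e g_def by simp
  qed
  define G where "G = (\<Sum>k. g k)"
  have g0: "g k \<ge> 0" for k
    by (simp add: g_def)
  have G: "sum g {..<n} \<le> G" "G \<ge> 0" for n
    unfolding G_def using \<open>summable g\<close> g0 by (auto intro: sum_le_suminf suminf_nonneg)
  \<comment> \<open>\<open>16 powr a\<close> comes from replacing \<open>2 ^ k\<close> by an index
    below \<open>16 * 2 ^ k\<close>, 14 rounds up 27/2, and the summand 1 accounts for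
    \<open>q 0 0\<close>.\<close>
  define C where "C = 16 powr a * (14 * G + 1)"
  have bound: "\<bar>A i l\<bar> \<le> C * real x powr - a" if x: "x = i \<or> x = l" for i l x
  proof (cases "i = 0")
    case True
    then show ?thesis
      using G by (simp add: A_def C_def)
  next
    case False
    have scale: "(2 powr - real k) powr a \<le> 16 powr a * real x powr - a"
      if "4 * 2 ^ k \<le> x" "x < 16 * 2 ^ k" for k
    proof -
      have "real x \<le> 16 * 2 powr k"
        using that(2) by (simp add: powr_realpow) (metis less_imp_le of_nat_le_numeral_power_cancel_iff of_nat_mult of_nat_numeral of_nat_power numeral_power_le_of_nat_cancel_iff of_nat_le_iff)
      moreover have "0 < real x"
        using that(1) by (metis gr0I le_zero_eq mult_eq_0_iff of_nat_0_less_iff power_eq_0_iff zero_neq_numeral)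
      ultimately have "2 powr - real k \<le> 16 * real x powr -1"
        by (simp add: powr_minus field_simps)
      then have "(2 powr - real k) powr a \<le> (16 * real x powr -1) powr a"
        using a by (intro powr_mono2) auto
      also have "\<dots> = 16 powr a * real x powr - a"
        by (simp only: powr_mult powr_powr mult_minus1)
      finally show ?thesis .
    qed
    define t where "t k = (D k i l - (real k + 1) * R k i l + R k l i / (real k + 1)) / 2 ^ Suc k" for k
    have "\<bar>t k\<bar> \<le> 14 * g k * (16 powr a * real x powr - a)" for k
    proof (cases "4 * 2 ^ k \<le> x \<and> x < 16 * 2 ^ k")
      case False
      then have "x \<notin> block k" "x \<notin> block (Suc k)"
        by (auto simp: block_def)
      then have "t k = 0"
        using x by (auto simp: t_def D_def R_def p_outside q_outside)
      then show ?thesis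
        using g0[of k] by simp
    next
      case True
      define b where "b = 9 * (real k + 1) / sqrt (2 ^ k)"
      have b0: "b \<ge> 0"
        by (simp add: b_def)
      have b: "\<bar>D k i l\<bar> \<le> b" "\<bar>R k i l\<bar> \<le> b" "\<bar>R k l i\<bar> \<le> b"
        unfolding b_def D_def R_def by (rule diag_flat off_diag_flat)+
      have "\<bar>D k i l - (real k + 1) * R k i l + R k l i / (real k + 1)\<bar>
        \<le> \<bar>D k i l\<bar> + (real k + 1) * \<bar>R k i l\<bar> + \<bar>R k l i\<bar> / (real k + 1)"
        by (rule order_trans[OF abs_triangle_ineq add_mono[OF order_trans[OF abs_triangle_ineq4]]])
          (simp_all add: abs_mult)
      also have "\<dots> \<le> (real k + 1) * b + (real k + 1) * b + (real k + 1) * b"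
      proof (intro add_mono)
        have "b \<le> (real k + 1) * b"
          using b0 by (simp add: distrib_right)
        then show "\<bar>D k i l\<bar> \<le> (real k + 1) * b"
          using b(1) by linarith
        show "(real k + 1) * \<bar>R k i l\<bar> \<le> (real k + 1) * b"
          using b(2) by (intro mult_left_mono) auto
        have "\<bar>R k l i\<bar> / (real k + 1) \<le> \<bar>R k l i\<bar> / 1"
          by (intro divide_left_mono) auto
        then show "\<bar>R k l i\<bar> / (real k + 1) \<le> (real k + 1) * b"
          using b(3) \<open>b \<le> (real k + 1) * b\<close> by simp
      qed
      also have "\<dots> = 3 * ((real k + 1) * b)"
        by simp
      finally have "\<bar>t k\<bar> \<le> 3 * ((real k + 1) * b) / 2 ^ Suc k"
        unfolding t_def abs_divide by (simp add: divide_right_mono del: power_Suc)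
      also have "\<dots> = 27 / 2 * ((real k + 1)\<^sup>2 * 2 powr (- (3 / 2) * k))"
      proof -
        have "sqrt (2 ^ k) = 2 powr (k / 2)"
          by (simp add: powr_half_sqrt[symmetric] powr_powr powr_realpow[symmetric])
        then have "1 / (2 ^ k * sqrt (2 ^ k)) = 2 powr (- (3 / 2) * k)"
          by (simp add: powr_realpow[symmetric] powr_add[symmetric] powr_minus_divide[symmetric])
        then show ?thesis
          by (simp add: b_def power2_eq_square field_simps)
      qed
      also have "\<dots> = 27 / 2 * (g k * (2 powr - real k) powr a)"
        by (simp add: g_def powr_powr powr_add[symmetric] algebra_simps)
      also have "\<dots> \<le> 14 * (g k * (16 powr a * real x powr - a))"
        using scale[of k] True g0[of k] by (intro mult_mono mult_left_mono) auto
      finally show ?thesis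
        by (simp add: mult_ac)
    qed
    then have "(\<Sum>k<i. \<bar>t k\<bar>) \<le> (\<Sum>k<i. 14 * g k * (16 powr a * real x powr - a))"
      by (intro sum_mono)
    also have "\<dots> = sum g {..<i} * (14 * (16 powr a * real x powr - a))"
      by (simp add: sum_distrib_right mult_ac)
    also have "\<dots> \<le> G * (14 * (16 powr a * real x powr - a))"
      using G by (intro mult_right_mono) auto
    finally have 1: "\<bar>\<Sum>k<i. t k\<bar> \<le> G * (14 * (16 powr a * real x powr - a))"
      using sum_abs[of t "{..<i}"] by linarith
    have 2: "\<bar>q 0 0 i * q 0 0 l\<bar> \<le> 16 powr a * real x powr - a"
    proof (cases "i \<in> block 0 \<and> l \<in> block 0")
      case True
      then have "q 0 0 i * q 0 0 i \<le> 1" "q 0 0 l * q 0 0 l \<le> 1"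
        using q_square[of i 0 0] q_square[of l 0 0] by auto
      then have "\<bar>q 0 0 i\<bar> \<le> 1" "\<bar>q 0 0 l\<bar> \<le> 1"
        using abs_le_square_iff[of _ 1] by (auto simp: power2_eq_square)
      then have "\<bar>q 0 0 i * q 0 0 l\<bar> \<le> 1"
        by (simp add: abs_mult mult_le_one)
      then show ?thesis
        using scale[of 0] True x by (auto simp: block_def)
    qed (auto simp: q_outside)
    show ?thesis
      unfolding A_eq_telescoped[OF order.refl, of i l] t_def[symmetric]
      using 1 2 by (simp add: C_def algebra_simps)
  qed
  have "C \<ge> 0"
    using G by (simp add: C_def)
  then show ?thesis
    using bound by blast
qed

text \<open>Pairing with \<open>p k j\<close> picks the single vector \<open>z k j\<close> with
  coefficient \<open>k + 1\<close>, and pairing with \<open>q (Suc k) j'\<close> picks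
  \<open>w k j'\<close> among the \<open>w k\<close> with coefficient \<open>- 1\<close>. This
  scalar block is the source of the lower bound at the critical exponent.\<close>

lemma A_off_diag_block:
  assumes "j < 2 * 2 ^ k" "j' < 2 * 2 ^ k"
  shows "(\<Sum>i\<in>block k. \<Sum>l\<in>block (Suc k). p k j i * A i l * q (Suc k) j' l)
    = (if j = j' then - (real k + 1) / 2 ^ Suc k else 0)"
proof -
  define n :: nat where "n = 16 * 2 ^ k"
  have n: "8 * 2 ^ k \<le> n" "8 * 2 ^ Suc k \<le> n"
    by (auto simp: n_def)
  have kn: "k < n"
    using less_four_power[of k] unfolding n_def by linarith
  have pz: "(\<Sum>i<n. p k j i * z k' s i) = (if k' = k \<and> s = j then real k + 1 else 0)"
    if "s < 2 * 2 ^ k'" for k' s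
  proof -
    have "(\<Sum>i<n. p k j i * z k' s i) =
        (\<Sum>i<n. (real k' + 1) * (p k j i * p k' s i)) + (\<Sum>i<n. p k j i * q (Suc k') s i)"
      unfolding sum.distrib[symmetric] by (intro sum.cong) (auto simp: z_def algebra_simps)
    then show ?thesis
      unfolding sum_distrib_left[symmetric] using dot_p_p[OF n(1) assms(1) that] dot_p_q[OF n(1) assms(1), of s "Suc k'"] that
      by auto
  qed
  have wq: "(\<Sum>l<n. q (Suc k) j' l * w k s l) = (if s = j' then -1 else 0)"
    if "s < 2 * 2 ^ k" for s
  proof -
    have "(\<Sum>l<n. q (Suc k) j' l * w k s l) =
        (\<Sum>l<n. 1 / (real k + 1) * (q (Suc k) j' l * p k s l)) - (\<Sum>l<n. q (Suc k) j' l * q (Suc k) s l)"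
      unfolding sum_subtractf[symmetric] by (intro sum.cong) (auto simp: w_def algebra_simps)
    then show ?thesis
      unfolding sum_distrib_left[symmetric] using dot_q_q[OF n(2), of j' s "Suc k"] dot_q_p[OF n(2), of j' s k] that assms
      by auto
  qed
  have "(\<Sum>i\<in>block k. \<Sum>l\<in>block (Suc k). p k j i * A i l * q (Suc k) j' l) =
     (\<Sum>i<n. \<Sum>l<n. p k j i * A i l * q (Suc k) j' l)"
  proof -
    have "(\<Sum>l<n. p k j i * A i l * q (Suc k) j' l) = (\<Sum>l\<in>block (Suc k). p k j i * A i l * q (Suc k) j' l)" for i
      by (rule sum_lessThan_block[OF n(2)]) (simp add: q_outside)
    then show ?thesis
      by (simp, subst sum_lessThan_block[OF n(1)]) (auto simp: p_outside)
  qed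
  also have "\<dots> = (\<Sum>i<n. \<Sum>l<n. \<Sum>k'<n. \<Sum>s<2 * 2 ^ k'.
      1 / 2 ^ Suc k' * ((p k j i * z k' s i) * (q (Suc k) j' l * w k' s l)))"
    by (intro sum.cong refl, subst A_eq[where n = n])
      (auto simp: sum_distrib_left sum_distrib_right sum_divide_distrib mult_ac)
  also have "\<dots> = (\<Sum>i<n. \<Sum>k'<n. \<Sum>l<n. \<Sum>s<2 * 2 ^ k'.
      1 / 2 ^ Suc k' * ((p k j i * z k' s i) * (q (Suc k) j' l * w k' s l)))"
    by (intro sum.cong refl sum.swap)
  also have "\<dots> = (\<Sum>i<n. \<Sum>k'<n. \<Sum>s<2 * 2 ^ k'. \<Sum>l<n.
      1 / 2 ^ Suc k' * ((p k j i * z k' s i) * (q (Suc k) j' l * w k' s l)))"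
    by (intro sum.cong refl sum.swap)
  also have "\<dots> = (\<Sum>k'<n. \<Sum>i<n. \<Sum>s<2 * 2 ^ k'. \<Sum>l<n.
      1 / 2 ^ Suc k' * ((p k j i * z k' s i) * (q (Suc k) j' l * w k' s l)))"
    by (rule sum.swap)
  also have "\<dots> = (\<Sum>k'<n. \<Sum>s<2 * 2 ^ k'. \<Sum>i<n. \<Sum>l<n.
      1 / 2 ^ Suc k' * ((p k j i * z k' s i) * (q (Suc k) j' l * w k' s l)))"
    by (intro sum.cong refl sum.swap)
  also have "\<dots> = (\<Sum>k'<n. \<Sum>s<2 * 2 ^ k'. 1 / 2 ^ Suc k' *
      ((\<Sum>i<n. p k j i * z k' s i) * (\<Sum>l<n. q (Suc k) j' l * w k' s l)))"
    unfolding sum_product by (simp add: sum_distrib_left)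
  also have "\<dots> = (\<Sum>k'<n. \<Sum>s<2 * 2 ^ k'. if k' = k \<and> s = j then
      1 / 2 ^ Suc k * ((real k + 1) * (\<Sum>l<n. q (Suc k) j' l * w k j l)) else 0)"
    using pz by (intro sum.cong refl) auto
  also have "\<dots> = (\<Sum>k'<n. if k' = k then
      1 / 2 ^ Suc k * ((real k + 1) * (\<Sum>l<n. q (Suc k) j' l * w k j l)) else 0)"
    using assms by (intro sum.cong refl) auto
  also have "\<dots> = 1 / 2 ^ Suc k * ((real k + 1) * (\<Sum>l<n. q (Suc k) j' l * w k j l))"
    using kn by simp
  also have "\<dots> = (if j = j' then - (real k + 1) / 2 ^ Suc k else 0)"
    using wq[OF assms(1)] by auto
  finally show ?thesis .
qed

end

subsection \<open>Rank one decompositions of scalar matrices\<close>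

lemma cmod_sum_mult_le_L2_set:
  fixes x y :: "'i \<Rightarrow> complex"
  shows "cmod (\<Sum>i\<in>S. x i * y i) \<le> L2_set (\<lambda>i. cmod (x i)) S * L2_set (\<lambda>i. cmod (y i)) S"
proof -
  have "cmod (\<Sum>i\<in>S. x i * y i) \<le> (\<Sum>i\<in>S. cmod (x i) * cmod (y i))"
    by (rule order_trans[OF norm_sum]) (simp add: norm_mult)
  also have "\<dots> = (\<Sum>i\<in>S. \<bar>cmod (x i)\<bar> * \<bar>cmod (y i)\<bar>)"
    by simp
  also have "\<dots> \<le> L2_set (\<lambda>i. cmod (x i)) S * L2_set (\<lambda>i. cmod (y i)) S"
    by (rule L2_set_mult_ineq)
  finally show ?thesis .
qed

lemma sum_mult_cnj_eq_L2_set: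
  "(\<Sum>i\<in>S. x i * cnj (x i)) = complex_of_real ((L2_set (\<lambda>i. cmod (x i)) S)\<^sup>2)"
proof -
  have "(L2_set (\<lambda>i. cmod (x i)) S)\<^sup>2 = (\<Sum>i\<in>S. (cmod (x i))\<^sup>2)"
    by (simp add: L2_set_def sum_nonneg)
  then show ?thesis
    by (simp only: of_real_sum complex_norm_square)
qed

text \<open>Cauchy-Schwarz, then cancellation of one factor. The hypothesis is the identity
  satisfied by an orthogonal projection \<open>s\<close> of \<open>x\<close>.\<close>

lemma L2_set_le_of_inner_eq:
  assumes "complex_of_real ((L2_set (\<lambda>i. cmod (s i)) S)\<^sup>2) = (\<Sum>i\<in>S. x i * cnj (s i))"
  shows "L2_set (\<lambda>i. cmod (s i)) S \<le> L2_set (\<lambda>i. cmod (x i)) S"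
proof -
  define Y where "Y = L2_set (\<lambda>i. cmod (s i)) S"
  have "Y\<^sup>2 = cmod (complex_of_real (Y\<^sup>2))"
    by (simp only: norm_of_real abs_power2)
  also have "\<dots> \<le> L2_set (\<lambda>i. cmod (x i)) S * Y"
    using cmod_sum_mult_le_L2_set[of x "\<lambda>i. cnj (s i)" S] assms by (simp add: Y_def)
  finally show ?thesis
    using L2_set_nonneg[of "\<lambda>i. cmod (s i)" S] L2_set_nonneg[of "\<lambda>i. cmod (x i)" S]
    unfolding Y_def[symmetric] by (cases "Y = 0") (auto simp: power2_eq_square)
qed

text \<open>The orthogonal projection \<open>s\<close> of \<open>x\<close> onto the span has the
  same norm \<open>Y\<close> as its coefficient family, and its inner product with \<open>x\<close>
  is \<open>Y^2\<close>.\<close>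

lemma bessel_inequality:
  fixes p :: "'j \<Rightarrow> 'i \<Rightarrow> real" and x :: "'i \<Rightarrow> complex"
  assumes "finite S" "finite J"
    and orth: "\<And>j l. j \<in> J \<Longrightarrow> l \<in> J \<Longrightarrow> (\<Sum>i\<in>S. p j i * p l i) = (if j = l then 1 else 0)"
  shows "L2_set (\<lambda>j. cmod (\<Sum>i\<in>S. p j i * x i)) J \<le> L2_set (\<lambda>i. cmod (x i)) S"
proof -
  define y where "y j = (\<Sum>i\<in>S. p j i * x i)" for j
  define s where "s i = (\<Sum>j\<in>J. p j i * y j)" for i
  define Y where "Y = L2_set (\<lambda>j. cmod (y j)) J"
  have orth': "(\<Sum>i\<in>S. complex_of_real (p j i) * p l i) = (if j = l then 1 else 0)"
    if "j \<in> J" "l \<in> J" for j l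
    using arg_cong[OF orth[OF that], of complex_of_real] by (simp split: if_splits)
  have "(\<Sum>i\<in>S. s i * cnj (s i)) = (\<Sum>i\<in>S. \<Sum>j\<in>J. \<Sum>l\<in>J. y j * cnj (y l) * (p j i * p l i))"
    by (simp add: s_def sum_product mult_ac)
  also have "\<dots> = (\<Sum>j\<in>J. \<Sum>i\<in>S. \<Sum>l\<in>J. y j * cnj (y l) * (p j i * p l i))"
    by (rule sum.swap)
  also have "\<dots> = (\<Sum>j\<in>J. \<Sum>l\<in>J. \<Sum>i\<in>S. y j * cnj (y l) * (p j i * p l i))"
    by (intro sum.cong refl sum.swap)
  also have "\<dots> = (\<Sum>j\<in>J. \<Sum>l\<in>J. if j = l then y j * cnj (y l) else 0)"
    using orth' by (intro sum.cong refl) (simp add: sum_distrib_left[symmetric])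
  also have "\<dots> = (\<Sum>j\<in>J. y j * cnj (y j))"
    using assms(2) by (simp add: sum.delta)
  finally have "L2_set (\<lambda>i. cmod (s i)) S = Y"
    unfolding sum_mult_cnj_eq_L2_set of_real_eq_iff Y_def by (simp add: L2_set_nonneg)
  moreover have "complex_of_real (Y\<^sup>2) = (\<Sum>i\<in>S. x i * cnj (s i))"
  proof -
    have "complex_of_real (Y\<^sup>2) = (\<Sum>j\<in>J. \<Sum>i\<in>S. x i * (p j i * cnj (y j)))"
      unfolding Y_def sum_mult_cnj_eq_L2_set[symmetric] by (simp add: y_def sum_distrib_right mult_ac)
    also have "\<dots> = (\<Sum>i\<in>S. \<Sum>j\<in>J. x i * (p j i * cnj (y j)))"
      by (rule sum.swap)
    finally show ?thesis
      by (simp add: s_def sum_distrib_left)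
  qed
  ultimately have "Y \<le> L2_set (\<lambda>i. cmod (x i)) S"
    using L2_set_le_of_inner_eq[of s S x] by simp
  then show ?thesis
    by (simp add: Y_def y_def)
qed

section \<open>Orthogonal projections as matrices, and their traces\<close>

definition projection :: "nat \<Rightarrow> (nat \<Rightarrow> nat \<Rightarrow> complex) \<Rightarrow> bool" where
  "projection m P \<longleftrightarrow> (\<forall>i<m. \<forall>j<m. P j i = cnj (P i j)) \<and>
     (\<forall>i<m. \<forall>l<m. (\<Sum>j<m. P i j * P j l) = P i l)"

lemma projection_cnj: "projection m P \<Longrightarrow> i < m \<Longrightarrow> j < m \<Longrightarrow> cnj (P i j) = P j i"
  unfolding projection_def by metis

lemma projection_idem: "projection m P \<Longrightarrow> i < m \<Longrightarrow> l < m \<Longrightarrow> (\<Sum>j<m. P i j * P j l) = P i l"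
  unfolding projection_def by blast

text \<open>\<open>v\<close> lies in the range of the self-adjoint idempotent \<open>P\<close>, so
  \<open>P\<close> fixes \<open>v\<close> and can be moved to the other argument of the inner
  product.\<close>

lemma projection_sum_cnj:
  assumes "projection m P" and v: "\<And>i. i < m \<Longrightarrow> v i = (\<Sum>j<m. P i j * u j)"
  shows "(\<Sum>j<m. cnj (v j) * x j) = (\<Sum>i<m. cnj (v i) * (\<Sum>j<m. P i j * x j))"
proof -
  have Pv: "(\<Sum>i<m. P j i * v i) = v j" if "j < m" for j
  proof -
    have "(\<Sum>i<m. P j i * v i) = (\<Sum>i<m. \<Sum>l<m. P j i * P i l * u l)"
      by (simp add: v sum_distrib_left mult.assoc)
    also have "\<dots> = (\<Sum>l<m. (\<Sum>i<m. P j i * P i l) * u l)"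
      by (subst sum.swap) (simp add: sum_distrib_right)
    also have "\<dots> = v j"
      using assms(1) that by (simp add: projection_idem v)
    finally show ?thesis .
  qed
  have "cnj (v j) = (\<Sum>i<m. cnj (v i) * P i j)" if "j < m" for j
    using arg_cong[OF Pv[OF that], of cnj, symmetric] assms(1) that
    by (simp add: projection_cnj mult.commute)
  then have "(\<Sum>j<m. cnj (v j) * x j) = (\<Sum>j<m. \<Sum>i<m. cnj (v i) * (P i j * x j))"
    by (intro sum.cong refl) (simp add: sum_distrib_right mult.assoc)
  also have "\<dots> = (\<Sum>i<m. \<Sum>j<m. cnj (v i) * (P i j * x j))"
    by (rule sum.swap)
  finally show ?thesis
    by (simp add: sum_distrib_left)
qed

lemma projection_L2_set_le:
  assumes "projection m P"
  shows "L2_set (\<lambda>i. cmod (\<Sum>j<m. P i j * u j)) {..<m} \<le> L2_set (\<lambda>i. cmod (u i)) {..<m}"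
proof -
  define v where "v i = (\<Sum>j<m. P i j * u j)" for i
  define V where "V = L2_set (\<lambda>i. cmod (v i)) {..<m}"
  have "complex_of_real (V\<^sup>2) = (\<Sum>i<m. cnj (v i) * (\<Sum>j<m. P i j * u j))"
    unfolding V_def sum_mult_cnj_eq_L2_set[symmetric] by (simp add: v_def mult.commute)
  also have "\<dots> = (\<Sum>i<m. cnj (v i) * u i)"
    by (rule projection_sum_cnj[OF assms, symmetric]) (rule v_def)
  finally have "complex_of_real (V\<^sup>2) = (\<Sum>i<m. u i * cnj (v i))"
    by (simp add: mult.commute)
  then have "V \<le> L2_set (\<lambda>i. cmod (u i)) {..<m}"
    using L2_set_le_of_inner_eq[of v "{..<m}" u] by (simp add: V_def)
  then show ?thesis
    by (simp add: V_def v_def)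
qed

text \<open>Gram-Schmidt: for each further vector the rank one projection onto its component
  \<open>v\<close> in the range of the current \<open>P\<close> is subtracted, which lowers the
  trace by 1; a vector with \<open>v = 0\<close> costs nothing.\<close>

lemma ex_annihilating_projection:
  fixes u :: "'b \<Rightarrow> nat \<Rightarrow> complex"
  assumes "finite B"
  shows "\<exists>P. projection m P \<and> (\<forall>b\<in>B. \<forall>i<m. (\<Sum>j<m. P i j * u b j) = 0) \<and>
    real m - real (card B) \<le> Re (\<Sum>i<m. P i i)"
  using assms
proof (induction B)
  case empty
  show ?case
    by (intro exI[of _ "\<lambda>i j. if i = j then 1 else 0"])
      (auto simp: projection_def if_distrib[of "\<lambda>x. x * _"] if_distrib[of "\<lambda>x. _ * x"] cong: if_cong)
next
  case (insert b B)
  then obtain P where P: "projection m P" "\<And>b i. b \<in> B \<Longrightarrow> i < m \<Longrightarrow> (\<Sum>j<m. P i j * u b j) = 0"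
    "real m - real (card B) \<le> Re (\<Sum>i<m. P i i)"
    by blast
  define v where "v i = (\<Sum>j<m. P i j * u b j)" for i
  define \<nu> where "\<nu> = (\<Sum>i<m. v i * cnj (v i))"
  note dot_v = projection_sum_cnj[OF P(1), of v "u b", OF v_def]
  show ?case
  proof (cases "\<nu> = 0")
    case True
    have "\<nu> = of_real ((L2_set (\<lambda>i. cmod (v i)) {..<m})\<^sup>2)"
      unfolding \<nu>_def by (rule sum_mult_cnj_eq_L2_set)
    then have "\<forall>i<m. v i = 0"
      using True by (simp add: L2_set_eq_0_iff)
    then show ?thesis
      using P insert by (intro exI[of _ P]) (auto simp: v_def)
  next
    case False
    define P' where "P' i j = P i j - v i * cnj (v j) / \<nu>" for i j
    have \<nu>: "cnj \<nu> = \<nu>"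
      by (simp add: \<nu>_def mult.commute)
    have P'_apply: "(\<Sum>j<m. P' i j * x j) = (\<Sum>j<m. P i j * x j) - v i * (\<Sum>j<m. cnj (v j) * x j) / \<nu>" for i x
      by (simp add: P'_def algebra_simps sum_subtractf sum_distrib_left sum_divide_distrib)
    have vv: "(\<Sum>j<m. cnj (v j) * v j) = \<nu>"
      by (simp add: \<nu>_def mult.commute)
    have Pv: "(\<Sum>j<m. P i j * v j) = v i" if "i < m" for i
    proof -
      have "(\<Sum>j<m. P i j * v j) = (\<Sum>j<m. \<Sum>l<m. P i j * P j l * u b l)"
        by (simp add: v_def sum_distrib_left mult.assoc)
      also have "\<dots> = (\<Sum>l<m. (\<Sum>j<m. P i j * P j l) * u b l)"
        by (subst sum.swap) (simp add: sum_distrib_right)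
      also have "\<dots> = v i"
        using P(1) that by (simp add: projection_idem v_def)
      finally show ?thesis .
    qed
    have "projection m P'"
      unfolding projection_def
    proof (intro conjI allI impI)
      fix i j assume ij: "i < m" "j < m"
      show "P' j i = cnj (P' i j)"
        using P(1) ij by (simp add: P'_def projection_cnj \<nu> mult.commute)
      have "(\<Sum>l<m. cnj (v l) * P l j) = cnj (v j)"
        using arg_cong[OF Pv[OF ij(2)], of cnj] P(1) ij by (simp add: projection_cnj mult.commute)
      then have "(\<Sum>l<m. cnj (v l) * P' l j) = 0"
        using False vv
        by (simp add: P'_def right_diff_distrib sum_subtractf sum_divide_distrib[symmetric]
            sum_distrib_right[symmetric] mult.assoc[symmetric])
      then have "(\<Sum>l<m. P' i l * P' l j) = (\<Sum>l<m. P i l * P' l j)"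
        by (simp add: P'_apply)
      also have "\<dots> = (\<Sum>l<m. P i l * P l j) - (\<Sum>l<m. P i l * v l) * cnj (v j) / \<nu>"
        by (simp add: P'_def right_diff_distrib sum_subtractf sum_divide_distrib
            sum_distrib_right mult.assoc)
      also have "\<dots> = P' i j"
        using P(1) ij Pv by (simp add: P'_def projection_idem)
      finally show "(\<Sum>l<m. P' i l * P' l j) = P' i j" .
    qed
    moreover have "(\<Sum>j<m. P' i j * u c j) = 0" if "c \<in> insert b B" "i < m" for c i
    proof (cases "c = b")
      case True
      have "(\<Sum>j<m. cnj (v j) * u b j) = \<nu>"
        using dot_v[of "u b"] vv by (simp add: v_def)
      then show ?thesis
        using False True by (simp add: P'_apply v_def)
    next
      case False
      then show ?thesis
        using that P(2) dot_v[of "u c"] by (simp add: P'_apply)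
    qed
    moreover have "real m - real (card (insert b B)) \<le> Re (\<Sum>i<m. P' i i)"
    proof -
      have "(\<Sum>i<m. P' i i) = (\<Sum>i<m. P i i) - 1"
        using False by (simp add: P'_def sum_subtractf sum_divide_distrib[symmetric] \<nu>_def[symmetric])
      then show ?thesis
        using P(3) insert.hyps by simp
    qed
    ultimately show ?thesis
      by blast
  qed
qed

text \<open>At most half of the dimension is taken up by the large terms; a projection that
  annihilates those terms still has trace at least \<open>m / 2\<close>.\<close>

lemma scalar_matrix_decomposition_lower_bound:
  fixes u g :: "nat \<Rightarrow> nat \<Rightarrow> complex" and m :: nat
  defines "a \<equiv> \<lambda>k. L2_set (\<lambda>i. cmod (u k i)) {..<m} * L2_set (\<lambda>i. cmod (g k i)) {..<m}"
  assumes \<tau>: "0 < \<tau>" and r: "0 < r" "r \<le> 1"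
    and sums: "\<And>i j. i < m \<Longrightarrow> j < m \<Longrightarrow>
      (\<lambda>k. u k i * g k j) sums (if i = j then complex_of_real \<tau> else 0)"
    and summable: "summable (\<lambda>k. a k powr r)"
  shows "\<tau> powr r * m / 2 \<le> (\<Sum>k. a k powr r)"
proof -
  have a0: "a k \<ge> 0" for k
    by (simp add: a_def L2_set_nonneg)
  define B where "B = {k. \<tau> < a k}"
  have "eventually (\<lambda>k. a k powr r < \<tau> powr r) sequentially"
    using order_tendstoD(2)[OF summable_LIMSEQ_zero[OF summable], of "\<tau> powr r"] \<tau> by simp
  then have "eventually (\<lambda>k. \<not> k \<in> B) sequentially"
  proof eventually_elim
    case (elim k)
    show ?case
    proof
      assume "k \<in> B"
      then have "\<tau> powr r \<le> a k powr r"
        using \<tau> r by (intro powr_mono2) (auto simp: B_def)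
      then show False
        using elim by simp
    qed
  qed
  then have B: "finite B"
    by (simp add: cofinite_eq_sequentially[symmetric] eventually_cofinite)
  show ?thesis
  proof (cases "real m / 2 \<le> card B")
    \<comment> \<open>At least \<open>m / 2\<close> large terms reach the bound on their
      own.\<close>
    case True
    have "\<tau> powr r * m / 2 \<le> \<tau> powr r * card B"
      using mult_left_mono[OF True, of "\<tau> powr r"] by simp
    also have "\<dots> = (\<Sum>k\<in>B. \<tau> powr r)"
      by simp
    also have "\<dots> \<le> (\<Sum>k\<in>B. a k powr r)"
      using \<tau> r by (intro sum_mono powr_mono2) (auto simp: B_def)
    also have "\<dots> \<le> (\<Sum>k. a k powr r)"
      using summable B by (intro sum_le_suminf) auto
    finally show ?thesis .
  next
    case False
    obtain P where P: "projection m P" "\<And>k i. k \<in> B \<Longrightarrow> i < m \<Longrightarrow> (\<Sum>j<m. P i j * u k j) = 0"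
      "real m - real (card B) \<le> Re (\<Sum>i<m. P i i)"
      using ex_annihilating_projection[OF B, of m u] by blast
    \<comment> \<open>\<open>c k\<close> is the trace of \<open>P\<close> times the
      \<open>k\<close>-th rank one term; these numbers sum to \<open>\<tau>\<close> times the trace
      of \<open>P\<close>.\<close>
    define c where "c k = (\<Sum>i<m. (\<Sum>j<m. P i j * u k j) * g k i)" for k
    have c: "cmod (c k) \<le> \<tau> powr (1 - r) * a k powr r" for k
    proof (cases "k \<in> B")
      case True
      then show ?thesis
        using P(2) by (simp add: c_def)
    next
      case False
      have "cmod (c k) \<le> L2_set (\<lambda>i. cmod (\<Sum>j<m. P i j * u k j)) {..<m} * L2_set (\<lambda>i. cmod (g k i)) {..<m}"
        unfolding c_def by (rule cmod_sum_mult_le_L2_set)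
      also have "\<dots> \<le> a k"
        unfolding a_def using projection_L2_set_le[OF P(1)] by (intro mult_right_mono) (auto simp: L2_set_nonneg)
      \<comment> \<open>Outside \<open>B\<close> the term is at most \<open>\<tau>\<close>, so the
        part \<open>a k powr (1 - r)\<close> can be bounded by
        \<open>\<tau> powr (1 - r)\<close>.\<close>
      also have "\<dots> = a k powr (1 - r) * a k powr r"
        using a0[of k] by (cases "a k = 0") (simp_all add: powr_add[symmetric])
      also have "\<dots> \<le> \<tau> powr (1 - r) * a k powr r"
        using False r a0 by (intro mult_right_mono powr_mono2) (auto simp: B_def)
      finally show ?thesis .
    qed
    have "(\<lambda>k. \<Sum>i<m. \<Sum>j<m. P i j * (u k j * g k i)) sums (\<Sum>i<m. \<Sum>j<m. P i j * (if j = i then complex_of_real \<tau> else 0))"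
      by (intro sums_sum sums_mult sums) auto
    then have c_sums: "c sums (\<tau> * (\<Sum>i<m. P i i))"
      by (simp add: c_def[abs_def] sum_distrib_right sum_distrib_left if_distrib[of "\<lambda>x. _ * x"] mult_ac cong: if_cong)
    have c_summable: "summable (\<lambda>k. cmod (c k))"
      by (rule summable_comparison_test'[OF summable_mult[OF summable]]) (use c in auto)
    have "\<tau> * (real m / 2) \<le> \<tau> * cmod (\<Sum>i<m. P i i)"
      using P(3) False complex_Re_le_cmod[of "\<Sum>i<m. P i i"] \<tau> by (intro mult_left_mono) linarith+
    also have "\<dots> = cmod (\<Sum>k. c k)"
      unfolding sums_unique[OF c_sums, symmetric] using \<tau> by (simp add: norm_mult)
    also have "\<dots> \<le> (\<Sum>k. cmod (c k))"
      by (rule summable_norm[OF c_summable])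
    also have "\<dots> \<le> (\<Sum>k. \<tau> powr (1 - r) * a k powr r)"
      by (rule suminf_le[OF c c_summable summable_mult[OF summable]])
    also have "\<dots> = \<tau> powr (1 - r) * (\<Sum>k. a k powr r)"
      by (rule suminf_mult[OF summable])
    finally have "\<tau> * (real m / 2) \<le> \<tau> powr (1 - r) * (\<Sum>k. a k powr r)" .
    then have "\<tau> powr (r - 1) * (\<tau> * (real m / 2)) \<le> \<tau> powr (r - 1) * (\<tau> powr (1 - r) * (\<Sum>k. a k powr r))"
      by (intro mult_left_mono) auto
    also have "\<tau> powr (r - 1) * (\<tau> powr (1 - r) * (\<Sum>k. a k powr r)) = (\<Sum>k. a k powr r)"
      using \<tau> by (simp only: mult.assoc[symmetric] powr_add[symmetric]) simp
    also have "\<tau> powr (r - 1) * (\<tau> * (real m / 2)) = \<tau> powr r * m / 2"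
      using \<tau> powr_mult_base[of \<tau> "r - 1"] by (simp add: mult_ac)
    finally show ?thesis .
  qed
qed

subsection \<open>Sequence spaces\<close>

text \<open>Young's inequality is applied to each \<open>f i powr b\<close> and the mean
  \<open>M\<close> of these values, with weights \<open>\<theta> = a / b\<close> and
  \<open>1 - \<theta>\<close>; summation turns the right-hand side into
  \<open>n * M\<close>.\<close>

lemma sum_powr_mean_le:
  fixes f :: "'i \<Rightarrow> real"
  assumes ab: "0 < a" "a \<le> b" and f: "\<And>i. i \<in> S \<Longrightarrow> 0 \<le> f i"
  shows "(\<Sum>i\<in>S. f i powr a) powr (1 / a) \<le> card S powr (1 / a - 1 / b) * (\<Sum>i\<in>S. f i powr b) powr (1 / b)"
proof (cases "finite S \<and> (\<Sum>i\<in>S. f i powr b) \<noteq> 0")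
  case False
  then have "(\<Sum>i\<in>S. f i powr a) = 0"
    by (cases "finite S") (auto simp: sum_nonneg_eq_0_iff)
  then show ?thesis by simp
next
  case True
  define n where "n = real (card S)"
  define B where "B = (\<Sum>i\<in>S. f i powr b)"
  have B: "B > 0"
    using True sum_nonneg[of S "\<lambda>i. f i powr b"] unfolding B_def by fastforce
  have n: "n > 0"
    using True by (auto simp: n_def card_gt_0_iff)
  define M where "M = B / n"
  define \<theta> where "\<theta> = a / b"
  have M: "M > 0" and \<theta>: "0 \<le> \<theta>" "0 \<le> 1 - \<theta>" "b * \<theta> = a"
    using B n ab by (auto simp: M_def \<theta>_def)
  have "f i powr a * M powr (1 - \<theta>) \<le> \<theta> * f i powr b + (1 - \<theta>) * M" if "i \<in> S" for i
  proof (cases "f i = 0")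
    case True
    then show ?thesis
      using M \<theta> by simp
  next
    case False
    then have "f i powr b > 0"
      using f[OF that] by simp
    then have "(f i powr b) powr \<theta> * M powr (1 - \<theta>) \<le> \<theta> * f i powr b + (1 - \<theta>) * M"
      using M \<theta> by (intro Youngs_inequality_0) auto
    then show ?thesis
      by (simp add: powr_powr \<theta>)
  qed
  then have "(\<Sum>i\<in>S. f i powr a * M powr (1 - \<theta>)) \<le> (\<Sum>i\<in>S. \<theta> * f i powr b + (1 - \<theta>) * M)"
    by (rule sum_mono)
  also have "\<dots> = \<theta> * B + (1 - \<theta>) * (n * M)"
    by (simp add: sum.distrib sum_distrib_left B_def n_def)
  also have "\<dots> = n * M"
    using n by (simp add: M_def algebra_simps)
  also have "\<dots> = n * (M powr \<theta> * M powr (1 - \<theta>))"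
    using M by (simp add: powr_add[symmetric])
  finally have "(\<Sum>i\<in>S. f i powr a) * M powr (1 - \<theta>) \<le> n * M powr \<theta> * M powr (1 - \<theta>)"
    by (simp add: sum_distrib_right mult.assoc)
  then have "(\<Sum>i\<in>S. f i powr a) \<le> n * M powr \<theta>"
    using M by simp
  then have "(\<Sum>i\<in>S. f i powr a) powr (1 / a) \<le> (n * M powr \<theta>) powr (1 / a)"
    using ab by (intro powr_mono2) (auto intro: sum_nonneg)
  also have "\<dots> = n powr (1 / a) * (B / n) powr (1 / b)"
    using ab by (simp add: powr_mult powr_powr \<theta>_def M_def)
  also have "\<dots> = n powr (1 / a - 1 / b) * B powr (1 / b)"
    by (simp add: powr_divide powr_diff)
  finally show ?thesis
    by (simp add: n_def B_def)
qed

text \<open>After division by \<open>s\<close>, the norm with exponent \<open>a\<close>, every entry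
  lies in [0, 1], where a larger exponent gives a smaller power.\<close>

lemma sum_powr_antimono:
  fixes f :: "'i \<Rightarrow> real"
  assumes ab: "0 < a" "a \<le> b" and f: "\<And>i. i \<in> S \<Longrightarrow> 0 \<le> f i"
  shows "(\<Sum>i\<in>S. f i powr b) powr (1 / b) \<le> (\<Sum>i\<in>S. f i powr a) powr (1 / a)"
proof (cases "finite S \<and> (\<Sum>i\<in>S. f i powr a) \<noteq> 0")
  case False
  then have "(\<Sum>i\<in>S. f i powr b) = 0"
    by (cases "finite S") (auto simp: sum_nonneg_eq_0_iff)
  then show ?thesis by simp
next
  case True
  define s where "s = (\<Sum>i\<in>S. f i powr a) powr (1 / a)"
  have S: "(\<Sum>i\<in>S. f i powr a) > 0"
    using True sum_nonneg[of S "\<lambda>i. f i powr a"] by fastforce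
  then have s: "s > 0" "s powr a = (\<Sum>i\<in>S. f i powr a)"
    using ab by (auto simp: s_def powr_powr)
  have "(f i / s) powr b \<le> (f i / s) powr a" if i: "i \<in> S" for i
  proof (cases "f i = 0")
    case False
    have "f i powr a \<le> s powr a"
      unfolding s(2) using i True by (intro member_le_sum) auto
    then have "f i \<le> s"
      using powr_less_mono2[of a s "f i"] ab s(1) by force
    then show ?thesis
      using False f[OF i] s(1) ab by (intro powr_mono') auto
  qed auto
  then have "(\<Sum>i\<in>S. (f i / s) powr b) \<le> (\<Sum>i\<in>S. (f i / s) powr a)"
    by (rule sum_mono)
  also have "\<dots> = 1"
    using s S by (simp add: powr_divide sum_divide_distrib[symmetric])
  finally have "(\<Sum>i\<in>S. f i powr b) \<le> s powr b"
    using s by (simp add: powr_divide sum_divide_distrib[symmetric])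
  then have "(\<Sum>i\<in>S. f i powr b) powr (1 / b) \<le> (s powr b) powr (1 / b)"
    using ab by (intro powr_mono2) (auto intro: sum_nonneg)
  then show ?thesis
    using ab s by (simp add: powr_powr s_def)
qed

lemma L2_set_eq_powr: "L2_set f S = (\<Sum>i\<in>S. \<bar>f i\<bar> powr 2) powr (1 / 2)"
  by (simp add: L2_set_def powr_half_sqrt sum_nonneg)

text \<open>The interface to the space, with \<open>t = 1 / p\<close>, through which
  \<open>l_p\<close> and \<open>c_0\<close> are treated alike. The exponents in
  \<open>L2_set_le_norm\<close> and \<open>norm_le_L2_set\<close> are those of the comparison
  between \<open>l_p\<close> and \<open>l_2\<close> in dimension \<open>card S\<close>; they add up
  to \<open>\<bar>1 / 2 - t\<bar>\<close>.\<close>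

locale sequence_lattice =
  fixes E :: seq_space and t :: real
  assumes t: "0 \<le> t" "t \<le> 1"
    and add: "x \<in> vecs E \<Longrightarrow> y \<in> vecs E \<Longrightarrow> (\<lambda>i. x i + y i) \<in> vecs E"
    and solid: "y \<in> vecs E \<Longrightarrow> (\<And>i. cmod (x i) \<le> cmod (y i)) \<Longrightarrow> x \<in> vecs E"
    and scale: "x \<in> vecs E \<Longrightarrow> (\<lambda>i. c * x i) \<in> vecs E"
    and norm_mono: "y \<in> vecs E \<Longrightarrow> (\<And>i. cmod (x i) \<le> cmod (y i)) \<Longrightarrow> vnorm E x \<le> vnorm E y"
    and norm_scale: "x \<in> vecs E \<Longrightarrow> vnorm E (\<lambda>i. c * x i) = cmod c * vnorm E x"
    and coord_le_norm: "x \<in> vecs E \<Longrightarrow> cmod (x i) \<le> vnorm E x"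
    and finite_support: "finite S \<Longrightarrow> (\<And>i. i \<notin> S \<Longrightarrow> x i = 0) \<Longrightarrow> x \<in> vecs E"
    and sum_le_norm: "finite S \<Longrightarrow> x \<in> vecs E \<Longrightarrow>
      (\<Sum>i\<in>S. cmod (x i)) \<le> card S powr (1 - t) * vnorm E x"
    and norm_le_sup: "finite S \<Longrightarrow> (\<And>i. i \<notin> S \<Longrightarrow> x i = 0) \<Longrightarrow> 0 \<le> M \<Longrightarrow>
      (\<And>i. cmod (x i) \<le> M) \<Longrightarrow> vnorm E x \<le> M * card S powr t"
    and L2_set_le_norm: "finite S \<Longrightarrow> x \<in> vecs E \<Longrightarrow>
      L2_set (\<lambda>i. cmod (x i)) S \<le> card S powr max (1 / 2 - t) 0 * vnorm E x"
    and norm_le_L2_set: "finite S \<Longrightarrow> (\<And>i. i \<notin> S \<Longrightarrow> x i = 0) \<Longrightarrow>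
      vnorm E x \<le> card S powr max (t - 1 / 2) 0 * L2_set (\<lambda>i. cmod (x i)) S"
    and norm_tail: "x \<in> vecs E \<Longrightarrow> (\<lambda>n. vnorm E (\<lambda>i. if i < n then 0 else x i)) \<longlonglongrightarrow> 0"
    and decay: "t < b \<Longrightarrow> \<exists>K\<ge>0. \<forall>x C. 0 \<le> C \<longrightarrow> (\<forall>i. cmod (x i) \<le> C * real i powr - b) \<longrightarrow>
      x \<in> vecs E \<and> vnorm E x \<le> C * K"

lemma c0_sequence_lattice: "sequence_lattice c0_space 0"
proof -
  have v: "x \<in> vecs c0_space \<longleftrightarrow> x \<longlonglongrightarrow> 0" for x
    by (simp add: c0_space_def)
  have n: "vnorm c0_space x = (SUP i. cmod (x i))" for x
    by (simp add: c0_space_def)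
  have bdd: "bdd_above (range (\<lambda>i. cmod (x i)))" if "x \<longlonglongrightarrow> 0" for x :: cseq
  proof -
    have "Bseq x"
      using that by (meson convergentI convergent_imp_Bseq)
    then show ?thesis
      by (auto simp: Bseq_def bdd_above_def)
  qed
  have fin: "x \<longlonglongrightarrow> 0" if "finite S" "\<And>i. i \<notin> S \<Longrightarrow> x i = 0" for S and x :: cseq
  proof (rule tendsto_eventually)
    show "eventually (\<lambda>i. x i = 0) sequentially"
      unfolding cofinite_eq_sequentially[symmetric] eventually_cofinite
      by (rule finite_subset[OF _ that(1)]) (use that(2) in auto)
  qed
  have coord: "cmod (x i) \<le> vnorm c0_space x" if "x \<longlonglongrightarrow> 0" for x i
    unfolding n using bdd[OF that] by (intro cSUP_upper) auto
  have sup_le: "vnorm c0_space x \<le> M" if "\<And>i. cmod (x i) \<le> M" for x M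
    unfolding n using that by (intro cSUP_least) auto
  have nonneg: "0 \<le> vnorm c0_space x" if "x \<longlonglongrightarrow> 0" for x
    using coord[OF that, of 0] norm_ge_zero order_trans by blast
  have solid: "x \<longlonglongrightarrow> 0" if "y \<longlonglongrightarrow> 0" "\<And>i. cmod (x i) \<le> cmod (y i)" for x y :: cseq
    by (rule Lim_null_comparison[OF _ tendsto_norm_zero[OF that(1)]]) (use that(2) in auto)
  show ?thesis
  proof (rule sequence_lattice.intro)
    show "(\<lambda>i. x i + y i) \<in> vecs c0_space" if "x \<in> vecs c0_space" "y \<in> vecs c0_space" for x y
      using that tendsto_add[of x 0 sequentially y 0] by (simp add: v)
    show "x \<in> vecs c0_space" if "y \<in> vecs c0_space" "\<And>i. cmod (x i) \<le> cmod (y i)" for x y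
      using that solid by (simp add: v)
    show "(\<lambda>i. c * x i) \<in> vecs c0_space" if "x \<in> vecs c0_space" for x c
      using that tendsto_mult_right_zero by (simp add: v)
    show "vnorm c0_space x \<le> vnorm c0_space y" if "y \<in> vecs c0_space" "\<And>i. cmod (x i) \<le> cmod (y i)" for x y
      using that coord[of y] by (intro sup_le) (auto simp: v intro: order_trans)
    show "vnorm c0_space (\<lambda>i. c * x i) = cmod c * vnorm c0_space x" if x: "x \<in> vecs c0_space" for x c
    proof (cases "c = 0")
      case True
      then show ?thesis by (simp add: n)
    next
      case False
      have le: "vnorm c0_space (\<lambda>i. c * x i) \<le> cmod c * vnorm c0_space x" if "x \<longlonglongrightarrow> 0" for x c
        using coord[OF that] by (intro sup_le) (simp add: norm_mult mult_left_mono)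
      have cx: "(\<lambda>i. c * x i) \<longlonglongrightarrow> 0"
        using x tendsto_mult_right_zero by (simp add: v)
      \<comment> \<open>The converse estimate is the same one for the factor
        \<open>inverse c\<close>.\<close>
      have "cmod c * vnorm c0_space x \<le> vnorm c0_space (\<lambda>i. c * x i)"
        using le[OF cx, of "inverse c"] False
        by (simp add: norm_divide field_simps)
      then show ?thesis
        using le[of x c] x by (simp add: v)
    qed
    show "cmod (x i) \<le> vnorm c0_space x" if "x \<in> vecs c0_space" for x i
      using that coord by (simp add: v)
    show "x \<in> vecs c0_space" if "finite S" "\<And>i. i \<notin> S \<Longrightarrow> x i = 0" for S x
      using that fin by (simp add: v)
    show "(\<Sum>i\<in>S. cmod (x i)) \<le> card S powr (1 - 0) * vnorm c0_space x"
      if "finite S" "x \<in> vecs c0_space" for S x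
      using sum_mono[of S "\<lambda>i. cmod (x i)" "\<lambda>_. vnorm c0_space x"] that coord by (simp add: v)
    \<comment> \<open>For empty \<open>S\<close> the factor \<open>card S powr 0\<close> is 0, since
      \<open>0 powr 0 = 0\<close>; then \<open>x\<close> is the zero sequence.\<close>
    show "vnorm c0_space x \<le> M * card S powr 0"
      if "finite S" "\<And>i. i \<notin> S \<Longrightarrow> x i = 0" "0 \<le> M" "\<And>i. cmod (x i) \<le> M" for S x M
      using that sup_le[of x M] sup_le[of x 0] by (cases "S = {}") auto
    show "L2_set (\<lambda>i. cmod (x i)) S \<le> card S powr max (1 / 2 - 0) 0 * vnorm c0_space x"
      if "finite S" "x \<in> vecs c0_space" for S x
    proof -
      have "L2_set (\<lambda>i. cmod (x i)) S \<le> L2_set (\<lambda>i. vnorm c0_space x) S"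
        using that coord by (intro L2_set_mono) (auto simp: v)
      also have "\<dots> = sqrt (card S) * vnorm c0_space x"
        using nonneg[of x] that by (simp add: L2_set_def real_sqrt_mult v)
      finally show ?thesis
        by (simp add: powr_half_sqrt)
    qed
    show "vnorm c0_space x \<le> card S powr max (0 - 1 / 2) 0 * L2_set (\<lambda>i. cmod (x i)) S"
      if S: "finite S" "\<And>i. i \<notin> S \<Longrightarrow> x i = 0" for S x
    proof -
      have "cmod (x i) \<le> L2_set (\<lambda>i. cmod (x i)) S" for i
        using S member_le_L2_set[of S i "\<lambda>i. cmod (x i)"] by (cases "i \<in> S") (auto simp: L2_set_nonneg)
      then have "vnorm c0_space x \<le> L2_set (\<lambda>i. cmod (x i)) S"
        by (rule sup_le)
      then show ?thesis
        using S by (cases "S = {}") auto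
    qed
    show "(\<lambda>m. vnorm c0_space (\<lambda>i. if i < m then 0 else x i)) \<longlonglongrightarrow> 0" if x: "x \<in> vecs c0_space" for x
    proof (rule LIMSEQ_I)
      fix e :: real assume e: "0 < e"
      obtain N where N: "\<And>i. i \<ge> N \<Longrightarrow> cmod (x i) < e / 2"
        using LIMSEQ_D[of x 0 "e / 2"] x e by (auto simp: v)
      have "norm (vnorm c0_space (\<lambda>i. if i < m then 0 else x i) - 0) < e" if "m \<ge> N" for m
      proof -
        have "(\<lambda>i. if i < m then 0 else x i) \<longlonglongrightarrow> 0"
          by (rule solid[of x]) (use x in \<open>auto simp: v\<close>)
        moreover have "vnorm c0_space (\<lambda>i. if i < m then 0 else x i) \<le> e / 2"
          by (rule sup_le) (use N that e in \<open>auto intro: less_imp_le\<close>)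
        ultimately show ?thesis
          using nonneg e by fastforce
      qed
      then show "\<exists>N. \<forall>m\<ge>N. norm (vnorm c0_space (\<lambda>i. if i < m then 0 else x i) - 0) < e"
        by blast
    qed
    show "\<exists>K\<ge>0. \<forall>x C. 0 \<le> C \<longrightarrow> (\<forall>i. cmod (x i) \<le> C * real i powr - b) \<longrightarrow>
      x \<in> vecs c0_space \<and> vnorm c0_space x \<le> C * K" if b: "0 < b" for b
    proof (intro exI[of _ "1::real"] conjI allI impI)
      fix x :: cseq and C assume C: "0 \<le> C" "\<forall>i. cmod (x i) \<le> C * real i powr - b"
      have "(\<lambda>i. real i powr - b) \<longlonglongrightarrow> 0"
        using b by real_asymp
      from tendsto_mult_right_zero[OF this, of C] show "x \<in> vecs c0_space"
        unfolding v by (rule Lim_null_comparison[rotated]) (use C in auto)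
      have "real i powr - b \<le> 1" for i
        using powr_mono[of "- b" 0 "real i"] b by (cases "i = 0") auto
      then have "cmod (x i) \<le> C * 1" for i
        using C mult_left_mono[of _ 1 C] order_trans by blast
      then show "vnorm c0_space x \<le> C * 1"
        by (rule sup_le)
    qed simp
  qed simp_all
qed

lemma lp_sequence_lattice:
  assumes p: "1 \<le> p"
  shows "sequence_lattice (lp_space p) (1 / p)"
proof -
  have v: "x \<in> vecs (lp_space p) \<longleftrightarrow> summable (\<lambda>i. cmod (x i) powr p)" for x
    by (simp add: lp_space_def)
  have n: "vnorm (lp_space p) x = (\<Sum>i. cmod (x i) powr p) powr (1 / p)" for x
    by (simp add: lp_space_def)
  have p0: "0 < p" using p by simp
  have fin_norm: "vnorm (lp_space p) x = (\<Sum>i\<in>S. cmod (x i) powr p) powr (1 / p)"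
    if "finite S" "\<And>i. i \<notin> S \<Longrightarrow> x i = 0" for S x
    unfolding n using that by (subst suminf_finite[of S]) auto
  have sum_le: "(\<Sum>i\<in>S. cmod (x i) powr p) powr (1 / p) \<le> vnorm (lp_space p) x"
    if "finite S" "x \<in> vecs (lp_space p)" for S x
    unfolding n using that p0 by (intro powr_mono2 sum_le_suminf) (auto simp: v intro: sum_nonneg)
  show ?thesis
  proof (rule sequence_lattice.intro)
    show "0 \<le> 1 / p" "1 / p \<le> 1"
      using p by auto
    show "(\<lambda>i. x i + y i) \<in> vecs (lp_space p)" if "x \<in> vecs (lp_space p)" "y \<in> vecs (lp_space p)" for x y
      unfolding v
    proof (rule summable_comparison_test')
      show "summable (\<lambda>i. 2 powr p * (cmod (x i) powr p + cmod (y i) powr p))"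
        using that by (intro summable_mult summable_add) (auto simp: v)
      fix i :: nat
      \<comment> \<open>Only summability is at stake, so twice the maximum serves in place of
        Minkowski's inequality.\<close>
      have "cmod (x i + y i) \<le> 2 * max (cmod (x i)) (cmod (y i))"
        using norm_triangle_ineq[of "x i" "y i"] by linarith
      then have "cmod (x i + y i) powr p \<le> (2 * max (cmod (x i)) (cmod (y i))) powr p"
        using p0 by (intro powr_mono2) auto
      also have "\<dots> = 2 powr p * max (cmod (x i)) (cmod (y i)) powr p"
        by (simp add: powr_mult)
      also have "\<dots> \<le> 2 powr p * (cmod (x i) powr p + cmod (y i) powr p)"
        by (intro mult_left_mono) (auto simp: max_def)
      finally show "norm (cmod (x i + y i) powr p) \<le> 2 powr p * (cmod (x i) powr p + cmod (y i) powr p)"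
        by simp
    qed
    have mono: "cmod (x i) powr p \<le> cmod (y i) powr p" if "\<And>i. cmod (x i) \<le> cmod (y i)" for x y :: cseq and i
      using that p0 by (intro powr_mono2) auto
    show solid: "x \<in> vecs (lp_space p)" if "y \<in> vecs (lp_space p)" "\<And>i. cmod (x i) \<le> cmod (y i)" for x y
      unfolding v by (rule summable_comparison_test'[where g = "\<lambda>i. cmod (y i) powr p"]) (use that mono[of x y] in \<open>auto simp: v\<close>)
    show "(\<lambda>i. c * x i) \<in> vecs (lp_space p)" if "x \<in> vecs (lp_space p)" for x c
      using that by (simp add: v norm_mult powr_mult summable_mult)
    show "vnorm (lp_space p) x \<le> vnorm (lp_space p) y" if "y \<in> vecs (lp_space p)" "\<And>i. cmod (x i) \<le> cmod (y i)" for x y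
      unfolding n using that solid[OF that] mono[OF that(2)] p0
      by (intro powr_mono2 suminf_le suminf_nonneg) (auto simp: v)
    show "vnorm (lp_space p) (\<lambda>i. c * x i) = cmod c * vnorm (lp_space p) x" if "x \<in> vecs (lp_space p)" for x c
      using that p0 by (simp add: n v norm_mult powr_mult suminf_mult powr_powr)
    show "cmod (x i) \<le> vnorm (lp_space p) x" if "x \<in> vecs (lp_space p)" for x i
      using sum_le[of "{i}" x] that p0 by (simp add: powr_powr)
    show "x \<in> vecs (lp_space p)" if "finite S" "\<And>i. i \<notin> S \<Longrightarrow> x i = 0" for S x
      unfolding v using that by (intro summable_finite[of S]) auto
    show "(\<Sum>i\<in>S. cmod (x i)) \<le> card S powr (1 - 1 / p) * vnorm (lp_space p) x"
      if "finite S" "x \<in> vecs (lp_space p)" for S x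
    proof -
      have "(\<Sum>i\<in>S. cmod (x i)) = (\<Sum>i\<in>S. cmod (x i) powr 1) powr (1 / 1)"
        by (simp add: sum_nonneg)
      also have "\<dots> \<le> card S powr (1 / 1 - 1 / p) * (\<Sum>i\<in>S. cmod (x i) powr p) powr (1 / p)"
        using p by (intro sum_powr_mean_le) auto
      also have "\<dots> \<le> card S powr (1 / 1 - 1 / p) * vnorm (lp_space p) x"
        using sum_le[OF that] by (intro mult_left_mono) auto
      finally show ?thesis by simp
    qed
    show "vnorm (lp_space p) x \<le> M * card S powr (1 / p)"
      if S: "finite S" "\<And>i. i \<notin> S \<Longrightarrow> x i = 0" "0 \<le> M" "\<And>i. cmod (x i) \<le> M" for S x M
    proof -
      have "(\<Sum>i\<in>S. cmod (x i) powr p) \<le> (\<Sum>i\<in>S. M powr p)"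
        using S p0 by (intro sum_mono powr_mono2) auto
      then have "vnorm (lp_space p) x \<le> (card S * M powr p) powr (1 / p)"
        using p0 fin_norm[of S x] S(1,2) by (auto intro!: powr_mono2 sum_nonneg)
      then show ?thesis
        using p0 S(3) by (simp add: powr_mult powr_powr mult.commute)
    qed
    show "L2_set (\<lambda>i. cmod (x i)) S \<le> card S powr max (1 / 2 - 1 / p) 0 * vnorm (lp_space p) x"
      if S: "finite S" "x \<in> vecs (lp_space p)" for S x
    proof -
      have "L2_set (\<lambda>i. cmod (x i)) S \<le> card S powr max (1 / 2 - 1 / p) 0 * (\<Sum>i\<in>S. cmod (x i) powr p) powr (1 / p)"
      proof (cases "p \<le> 2")
        case True
        then have "max (1 / 2 - 1 / p) 0 = 0"
          using p0 by (simp add: field_simps)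
        then show ?thesis
          using sum_powr_antimono[of p 2 S "\<lambda>i. cmod (x i)"] True p0 S(1)
          by (cases "S = {}") (auto simp: L2_set_eq_powr)
      next
        case False
        then have "max (1 / 2 - 1 / p) 0 = 1 / 2 - 1 / p"
          by (simp add: field_simps)
        then show ?thesis
          using sum_powr_mean_le[of 2 p S "\<lambda>i. cmod (x i)"] False by (simp add: L2_set_eq_powr)
      qed
      also have "\<dots> \<le> card S powr max (1 / 2 - 1 / p) 0 * vnorm (lp_space p) x"
        using sum_le[OF S] by (intro mult_left_mono) auto
      finally show ?thesis .
    qed
    show "vnorm (lp_space p) x \<le> card S powr max (1 / p - 1 / 2) 0 * L2_set (\<lambda>i. cmod (x i)) S"
      if S: "finite S" "\<And>i. i \<notin> S \<Longrightarrow> x i = 0" for S x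
    proof -
      have eq: "vnorm (lp_space p) x = (\<Sum>i\<in>S. cmod (x i) powr p) powr (1 / p)"
        by (rule fin_norm) (use S in auto)
      show ?thesis
      proof (cases "2 \<le> p")
        case True
        then have "max (1 / p - 1 / 2) 0 = 0"
          by (simp add: field_simps)
        then show ?thesis
          using sum_powr_antimono[of 2 p S "\<lambda>i. cmod (x i)"] True S(1)
          by (cases "S = {}") (auto simp: L2_set_eq_powr eq)
      next
        case False
        then have "max (1 / p - 1 / 2) 0 = 1 / p - 1 / 2"
          using p0 by (simp add: field_simps)
        then show ?thesis
          using sum_powr_mean_le[of p 2 S "\<lambda>i. cmod (x i)"] False p0 by (simp add: L2_set_eq_powr eq)
      qed
    qed
    show "(\<lambda>m. vnorm (lp_space p) (\<lambda>i. if i < m then 0 else x i)) \<longlonglongrightarrow> 0" if x: "x \<in> vecs (lp_space p)" for x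
    proof -
      have sx: "summable (\<lambda>i. cmod (x i) powr p)"
        using x by (simp add: v)
      have "(\<Sum>i. cmod (if i < m then 0 else x i) powr p) = (\<Sum>i. cmod (x i) powr p) - (\<Sum>i<m. cmod (x i) powr p)" for m
      proof -
        have "summable (\<lambda>i. cmod (if i < m then 0 else x i) powr p)"
          using solid[OF x, of "\<lambda>i. if i < m then 0 else x i"] by (simp add: v)
        from suminf_split_initial_segment[OF this, of m] show ?thesis
          using suminf_minus_initial_segment[OF sx, of m] by simp
      qed
      moreover have "(\<lambda>m. (\<Sum>i. cmod (x i) powr p) - (\<Sum>i<m. cmod (x i) powr p)) \<longlonglongrightarrow> 0"
        using tendsto_diff[OF tendsto_const summable_LIMSEQ[OF sx], of "\<Sum>i. cmod (x i) powr p"] by simp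
      ultimately have "(\<lambda>m. \<Sum>i. cmod (if i < m then 0 else x i) powr p) \<longlonglongrightarrow> 0"
        by simp
      moreover have "eventually (\<lambda>m. 0 \<le> (\<Sum>i. cmod (if i < m then 0 else x i) powr p)) sequentially"
        using solid[OF x, of "\<lambda>i. if i < _ then 0 else x i"] by (intro always_eventually allI suminf_nonneg) (auto simp: v)
      ultimately have "(\<lambda>m. (\<Sum>i. cmod (if i < m then 0 else x i) powr p) powr (1 / p)) \<longlonglongrightarrow> 0 powr (1 / p)"
        using p0 by (intro tendsto_powr2) auto
      then show ?thesis
        by (simp add: n)
    qed
    show "\<exists>K\<ge>0. \<forall>x C. 0 \<le> C \<longrightarrow> (\<forall>i. cmod (x i) \<le> C * real i powr - b) \<longrightarrow>
      x \<in> vecs (lp_space p) \<and> vnorm (lp_space p) x \<le> C * K" if b: "1 / p < b" for b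
    proof -
      \<comment> \<open>\<open>1 / p < b\<close> means \<open>b * p > 1\<close>, so the dominating
        series converges; its norm is the constant \<open>K\<close>.\<close>
      have bp: "summable (\<lambda>i. real i powr (- b * p))"
        using b p0 by (subst summable_real_powr_iff) (simp add: field_simps)
      define K where "K = (\<Sum>i. real i powr (- b * p)) powr (1 / p)"
      have "x \<in> vecs (lp_space p) \<and> vnorm (lp_space p) x \<le> C * K"
        if C: "0 \<le> C" "\<forall>i. cmod (x i) \<le> C * real i powr - b" for x C
      proof
        have le: "cmod (x i) powr p \<le> C powr p * real i powr (- b * p)" for i
          using C(2) p0 powr_mono2[of p "cmod (x i)" "C * real i powr - b"]
          by (simp add: powr_mult powr_powr)
        show vx: "x \<in> vecs (lp_space p)"
          unfolding v by (rule summable_comparison_test'[OF summable_mult[OF bp, of "C powr p"]]) (use le in auto)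
        have "(\<Sum>i. cmod (x i) powr p) \<le> (\<Sum>i. C powr p * real i powr (- b * p))"
          using le vx summable_mult[OF bp, of "C powr p"] by (intro suminf_le) (auto simp: v)
        also have "\<dots> = C powr p * (\<Sum>i. real i powr (- b * p))"
          using bp by (rule suminf_mult)
        finally have "vnorm (lp_space p) x \<le> (C powr p * (\<Sum>i. real i powr (- b * p))) powr (1 / p)"
          unfolding n using p0 vx by (intro powr_mono2 suminf_nonneg) (auto simp: v)
        then show "vnorm (lp_space p) x \<le> C * K"
          using C(1) p0 by (simp add: powr_mult powr_powr K_def)
      qed
      moreover have "K \<ge> 0"
        by (simp add: K_def)
      ultimately show ?thesis by blast
    qed
  qed
qed

subsection \<open>The nuclear operator\<close>

abbreviation unit_vec :: "nat \<Rightarrow> cseq" where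
  "unit_vec j \<equiv> \<lambda>i. if i = j then 1 else 0"

section \<open>Functionals and the trace on a sequence lattice\<close>

context sequence_lattice
begin

lemma zero_vec: "(\<lambda>i. 0) \<in> vecs E"
  by (rule finite_support[of "{}"]) auto

lemma unit_vec: "unit_vec j \<in> vecs E"
  by (rule finite_support[of "{j}"]) auto

lemma norm_unit_vec_le: "vnorm E (unit_vec j) \<le> 1"
  using norm_le_sup[of "{j}" "unit_vec j" 1] by auto

lemma vnorm_nonneg: "x \<in> vecs E \<Longrightarrow> 0 \<le> vnorm E x"
  using coord_le_norm[of x 0] norm_ge_zero order_trans by blast

lemma vnorm_zero: "vnorm E (\<lambda>i. 0) = 0"
  using norm_scale[OF zero_vec, of 0] by simp

lemma dual_add: "f \<in> dual E \<Longrightarrow> x \<in> vecs E \<Longrightarrow> y \<in> vecs E \<Longrightarrow> f (\<lambda>i. x i + y i) = f x + f y"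
  unfolding dual_def by blast

lemma dual_scale: "f \<in> dual E \<Longrightarrow> x \<in> vecs E \<Longrightarrow> f (\<lambda>i. c * x i) = c * f x"
  unfolding dual_def by blast

lemma dual_zero: "f \<in> dual E \<Longrightarrow> f (\<lambda>i. 0) = 0"
  using dual_scale[OF _ zero_vec, of f 0] by simp

text \<open>\<open>dual_norm\<close> is a supremum of reals, so it bounds the value at the
  normalised vector \<open>y\<close> only once the set of values is known to be bounded. The
  constant \<open>B\<close> from \<open>dual\<close> provides this and also settles vectors of norm
  0.\<close>

lemma norm_apply_le:
  assumes f: "f \<in> dual E" and x: "x \<in> vecs E"
  shows "cmod (f x) \<le> dual_norm E f * vnorm E x"
proof -
  obtain B where B: "\<And>x. x \<in> vecs E \<Longrightarrow> cmod (f x) \<le> B * vnorm E x"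
    using f unfolding dual_def by blast
  show ?thesis
  proof (cases "vnorm E x = 0")
    case True
    then show ?thesis
      using B[OF x] by simp
  next
    case False
    then have pos: "vnorm E x > 0"
      using vnorm_nonneg[OF x] by simp
    define y where "y = (\<lambda>i. complex_of_real (1 / vnorm E x) * x i)"
    have y: "y \<in> vecs E" "vnorm E y = 1"
      unfolding y_def using scale[OF x] norm_scale[OF x, of "complex_of_real (1 / vnorm E x)"] pos
      by (blast, simp add: norm_divide)
    have "bdd_above ((\<lambda>x. cmod (f x)) ` {x \<in> vecs E. vnorm E x \<le> 1})"
    proof (rule bdd_aboveI2)
      fix z assume z: "z \<in> {x \<in> vecs E. vnorm E x \<le> 1}"
      then have "cmod (f z) \<le> B * vnorm E z"
        using B by auto
      also have "\<dots> \<le> \<bar>B\<bar> * vnorm E z"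
        using z vnorm_nonneg by (intro mult_right_mono) auto
      also have "\<dots> \<le> \<bar>B\<bar> * 1"
        using z by (intro mult_left_mono) auto
      finally show "cmod (f z) \<le> \<bar>B\<bar>" by simp
    qed
    then have "cmod (f y) \<le> dual_norm E f"
      unfolding dual_norm_def by (rule cSUP_upper[rotated]) (use y in auto)
    moreover have "cmod (f y) = cmod (f x) / vnorm E x"
      unfolding y_def dual_scale[OF f x] using pos by (simp add: norm_mult norm_divide)
    ultimately show ?thesis
      using pos by (simp add: field_simps)
  qed
qed

lemma dual_norm_le:
  assumes "\<And>x. x \<in> vecs E \<Longrightarrow> cmod (f x) \<le> M * vnorm E x" "0 \<le> M"
  shows "dual_norm E f \<le> M"
  unfolding dual_norm_def
proof (rule cSUP_least)
  show "{x \<in> vecs E. vnorm E x \<le> 1} \<noteq> {}"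
    using zero_vec vnorm_zero by force
  fix x assume x: "x \<in> {x \<in> vecs E. vnorm E x \<le> 1}"
  have "M * vnorm E x \<le> M * 1"
    using x assms(2) by (intro mult_left_mono) auto
  then show "cmod (f x) \<le> M"
    using assms(1)[of x] x by simp
qed

lemma dual_norm_nonneg:
  assumes f: "f \<in> dual E"
  shows "0 \<le> dual_norm E f"
proof (rule ccontr)
  assume neg: "\<not> 0 \<le> dual_norm E f"
  have pos: "0 < vnorm E (unit_vec 0)"
    using coord_le_norm[OF unit_vec, of 0 0] by simp
  then have "dual_norm E f * vnorm E (unit_vec 0) < 0"
    using neg by (simp add: mult_less_0_iff)
  then show False
    using norm_apply_le[OF f unit_vec, of 0] norm_ge_zero order_trans not_less by blast
qed

lemma apply_finite_support:
  assumes f: "f \<in> dual E"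
  shows "finite S \<Longrightarrow> (\<And>i. i \<notin> S \<Longrightarrow> x i = 0) \<Longrightarrow> f x = (\<Sum>i\<in>S. x i * f (unit_vec i))"
proof (induction S arbitrary: x rule: finite_induct)
  case empty
  then have "x = (\<lambda>i. 0)" by auto
  then show ?case
    using dual_zero[OF f] by simp
next
  case (insert s S)
  define y where "y = x(s := 0)"
  have y: "y \<in> vecs E"
    by (rule finite_support[of S]) (use insert in \<open>auto simp: y_def\<close>)
  have "f x = f (\<lambda>i. x s * unit_vec s i + y i)"
    by (rule arg_cong[where f = f]) (auto simp: y_def)
  also have "\<dots> = f (\<lambda>i. x s * unit_vec s i) + f y"
    by (rule dual_add[OF f scale[OF unit_vec] y])
  also have "f (\<lambda>i. x s * unit_vec s i) = x s * f (unit_vec s)"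
    by (rule dual_scale[OF f unit_vec])
  also have "f y = (\<Sum>i\<in>S. y i * f (unit_vec i))"
    using insert.prems by (intro insert.IH) (auto simp: y_def)
  also have "\<dots> = (\<Sum>i\<in>S. x i * f (unit_vec i))"
    using insert.hyps by (intro sum.cong) (auto simp: y_def)
  finally show ?case
    using insert.hyps by simp
qed

text \<open>Testing \<open>f\<close> on the vector \<open>x\<close> of its own conjugated
  coefficients yields \<open>L^2\<close>, while \<open>norm_le_L2_set\<close> bounds the norm of
  \<open>x\<close> by a multiple of \<open>L\<close>; one factor \<open>L\<close> cancels.\<close>

lemma L2_set_apply_unit_vec_le:
  assumes f: "f \<in> dual E" and S: "finite S"
  shows "L2_set (\<lambda>i. cmod (f (unit_vec i))) S \<le> card S powr max (t - 1 / 2) 0 * dual_norm E f"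
proof -
  define L where "L = L2_set (\<lambda>i. cmod (f (unit_vec i))) S"
  define x where "x i = (if i \<in> S then cnj (f (unit_vec i)) else 0)" for i
  have x: "x \<in> vecs E"
    by (rule finite_support[OF S]) (simp add: x_def)
  have "f x = (\<Sum>i\<in>S. x i * f (unit_vec i))"
    by (rule apply_finite_support[OF f S]) (simp add: x_def)
  also have "\<dots> = (\<Sum>i\<in>S. f (unit_vec i) * cnj (f (unit_vec i)))"
    by (intro sum.cong) (auto simp: x_def)
  also have "\<dots> = of_real (L\<^sup>2)"
    unfolding L_def by (rule sum_mult_cnj_eq_L2_set)
  finally have "L\<^sup>2 = cmod (f x)"
    by (simp add: norm_power L_def L2_set_nonneg)
  also have "\<dots> \<le> dual_norm E f * vnorm E x"
    by (rule norm_apply_le[OF f x])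
  also have "\<dots> \<le> dual_norm E f * (card S powr max (t - 1 / 2) 0 * L2_set (\<lambda>i. cmod (x i)) S)"
    by (intro mult_left_mono norm_le_L2_set S dual_norm_nonneg[OF f]) (simp add: x_def)
  also have "L2_set (\<lambda>i. cmod (x i)) S = L"
    unfolding L_def by (intro L2_set_cong) (auto simp: x_def)
  finally have "L * L \<le> card S powr max (t - 1 / 2) 0 * dual_norm E f * L"
    by (simp add: power2_eq_square mult_ac)
  moreover have "0 \<le> L"
    by (simp add: L_def L2_set_nonneg)
  ultimately show ?thesis
    using dual_norm_nonneg[OF f] unfolding L_def[symmetric] by (cases "L = 0") auto
qed

text \<open>Each coordinate is dominated by the norm, so the partial sums converge coordinatewise.
  This turns a representation into identities between matrix entries.\<close>

lemma nuclear_rep_sums_coord: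
  assumes rep: "nuclear_rep E s T f v" and x: "x \<in> vecs E" "T x \<in> vecs E"
  shows "(\<lambda>k. f k x * v k i) sums T x i"
proof -
  have v: "v k \<in> vecs E" for k
    using rep by (simp add: nuclear_rep_def)
  have diff: "(\<lambda>i. T x i - (\<Sum>k<n. f k x * v k i)) \<in> vecs E" for n
  proof (induction n)
    case (Suc n)
    from add[OF this scale[OF v[of n], of "- f n x"]] show ?case
      by (simp add: algebra_simps)
  qed (use x in simp)
  have le: "cmod (T x i - (\<Sum>k<n. f k x * v k i)) \<le> vnorm E (\<lambda>i. T x i - (\<Sum>k<n. f k x * v k i))" for n
    by (rule coord_le_norm[OF diff])
  have "(\<lambda>n. T x i - (\<Sum>k<n. f k x * v k i)) \<longlonglongrightarrow> 0"
  proof (rule Lim_null_comparison)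
    show "(\<lambda>n. vnorm E (\<lambda>i. T x i - (\<Sum>k<n. f k x * v k i))) \<longlonglongrightarrow> 0"
      using rep x(1) unfolding nuclear_rep_def by blast
  qed (use le in simp)
  from tendsto_diff[OF tendsto_const[of "T x i"] this] show ?thesis
    by (simp add: sums_def)
qed

text \<open>The truncations to the first \<open>n\<close> coordinates are finite rank operators that converge
  pointwise to the identity; they replace the approximation property.\<close>

lemma nuclear_rep_trace_sums:
  assumes rep: "nuclear_rep E 1 T f v" and T: "\<And>i. T (unit_vec i) \<in> vecs E"
    and tr: "(\<lambda>i. T (unit_vec i) i) sums \<tau>"
  shows "(\<lambda>k. f k (v k)) sums \<tau>"
proof -
  have f: "f k \<in> dual E" and v: "v k \<in> vecs E" for k
    using rep by (auto simp: nuclear_rep_def)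
  define M where "M k = dual_norm E (f k) * vnorm E (v k)" for k
  have M: "summable M"
    using rep dual_norm_nonneg[OF f] vnorm_nonneg[OF v] by (simp add: nuclear_rep_def M_def[abs_def])
  define cut tail where "cut n k i = (if i < n then v k i else 0)"
    and "tail n k i = (if i < n then 0 else v k i)" for n k i
  have cut: "cut n k \<in> vecs E" and tail: "tail n k \<in> vecs E" for n k
    by (rule solid[OF v[of k]], simp add: cut_def tail_def)+
  have cut_bound: "cmod (f k (cut n k)) \<le> M k" for k n
  proof -
    have "cmod (f k (cut n k)) \<le> dual_norm E (f k) * vnorm E (cut n k)"
      by (rule norm_apply_le[OF f cut])
    also have "\<dots> \<le> M k"
      unfolding M_def by (intro mult_left_mono norm_mono[OF v] dual_norm_nonneg[OF f]) (simp add: cut_def)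
    finally show ?thesis .
  qed
  have lim: "(\<lambda>n. f k (cut n k)) \<longlonglongrightarrow> f k (v k)" for k
  proof -
    have eq: "f k (cut n k) = f k (v k) - f k (tail n k)" for n
    proof -
      have "v k = (\<lambda>i. cut n k i + tail n k i)"
        by (auto simp: cut_def tail_def)
      then show ?thesis
        using dual_add[OF f cut tail, of k n k n k] by simp
    qed
    have "(\<lambda>n. f k (tail n k)) \<longlonglongrightarrow> 0"
    proof (rule Lim_null_comparison)
      show "eventually (\<lambda>n. norm (f k (tail n k)) \<le> dual_norm E (f k) * vnorm E (tail n k)) sequentially"
        using norm_apply_le[OF f tail] by simp
      have "(\<lambda>n. vnorm E (tail n k)) \<longlonglongrightarrow> 0"
        using norm_tail[OF v[of k]] by (simp add: tail_def[abs_def])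
      from tendsto_mult_right_zero[OF this] show "(\<lambda>n. dual_norm E (f k) * vnorm E (tail n k)) \<longlonglongrightarrow> 0" .
    qed
    from tendsto_diff[OF tendsto_const this] show ?thesis
      by (simp add: eq)
  qed
  \<comment> \<open>For fixed \<open>n\<close> this is the trace of the truncated operator, a finite
    sum of coordinate identities at unit vectors.\<close>
  have "(\<lambda>k. f k (cut n k)) sums (\<Sum>i<n. T (unit_vec i) i)" for n
  proof -
    have "f k (cut n k) = (\<Sum>i<n. f k (unit_vec i) * v k i)" for k
      by (subst apply_finite_support[OF f, of "{..<n}"]) (auto simp: cut_def mult.commute)
    then show ?thesis
      using sums_sum[of "{..<n}" "\<lambda>i k. f k (unit_vec i) * v k i" "\<lambda>i. T (unit_vec i) i"]
        nuclear_rep_sums_coord[OF rep unit_vec T] by simp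
  qed
  then have "(\<Sum>k. f k (cut n k)) = (\<Sum>i<n. T (unit_vec i) i)" for n
    by (rule sums_unique[symmetric])
  then have "(\<lambda>n. \<Sum>k. f k (cut n k)) \<longlonglongrightarrow> \<tau>"
    using tr by (simp add: sums_def)
  \<comment> \<open>Dominated convergence for series, with the summable majorant \<open>M\<close>,
    exchanges the limit in \<open>n\<close> with the sum over \<open>k\<close>.\<close>
  moreover have tannery: "eventually (\<lambda>n. summable (\<lambda>k. norm (f k (cut n k)))) sequentially \<and>
      summable (\<lambda>k. norm (f k (v k))) \<and>
      ((\<lambda>n. \<Sum>k. f k (cut n k)) \<longlonglongrightarrow> (\<Sum>k. f k (v k)))"
    by (rule tannerys_theorem[OF lim _ M]) (simp_all add: cut_bound case_prod_unfold)
  ultimately have "(\<Sum>k. f k (v k)) = \<tau>"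
    using LIMSEQ_unique by blast
  then show ?thesis
    using summable_norm_cancel[of "\<lambda>k. f k (v k)"] tannery by (simp add: sums_iff)
qed

text \<open>Nuclearity supplies a representation, and every representation has the sum
  \<open>\<tau>\<close>, so the definite description has exactly one candidate.\<close>

lemma nuclear_trace_eq:
  assumes T: "T \<in> nuclear_ops E 1" and tr: "(\<lambda>i. T (unit_vec i) i) sums \<tau>"
  shows "nuclear_trace E T = \<tau>"
  unfolding nuclear_trace_def
proof (rule the_equality)
  have TE: "T (unit_vec i) \<in> vecs E" for i
    using T unit_vec by (simp add: nuclear_ops_def operators_def)
  show "\<exists>f v. nuclear_rep E 1 T f v \<and> (\<lambda>k. f k (v k)) sums \<tau>"
    using T nuclear_rep_trace_sums[OF _ TE tr] by (auto simp: nuclear_ops_def)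
  show "t = \<tau>" if "\<exists>f v. nuclear_rep E 1 T f v \<and> (\<lambda>k. f k (v k)) sums t" for t
    using that nuclear_rep_trace_sums[OF _ TE tr] sums_unique2 by blast
qed

end

section \<open>The operator of the matrix and its nuclear representations\<close>

locale frames_on_lattice = sequence_lattice E t + frames p q
  for E t p q
begin

text \<open>Row \<open>i\<close> of \<open>A\<close> vanishes from column \<open>4 * i\<close> on,
  so the matrix acts on arbitrary sequences through finite sums.\<close>

definition V :: "cseq \<Rightarrow> cseq" where
  "V x i = (\<Sum>l<4 * i. complex_of_real (A i l) * x l)"

lemma V_extend:
  assumes "4 * i \<le> n"
  shows "V x i = (\<Sum>l<n. complex_of_real (A i l) * x l)"
  unfolding V_def
proof (rule sum.mono_neutral_left)
  show "\<forall>l\<in>{..<n} - {..<4 * i}. complex_of_real (A i l) * x l = 0"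
  proof
    fix l assume "l \<in> {..<n} - {..<4 * i}"
    then have "A i l = 0"
      using A_support[of i l] by fastforce
    then show "complex_of_real (A i l) * x l = 0"
      by simp
  qed
qed (use assms in auto)

lemma V_unit_vec: "V (unit_vec l) i = A i l"
proof -
  have "V (unit_vec l) i = (\<Sum>m<max (4 * i) (Suc l). complex_of_real (A i m) * unit_vec l m)"
    by (rule V_extend) simp
  also have "\<dots> = (\<Sum>m<max (4 * i) (Suc l). if m = l then complex_of_real (A i l) else 0)"
    by (intro sum.cong) auto
  finally show ?thesis by simp
qed

lemma V_V: "V (V x) i = 0"
proof -
  \<comment> \<open>Rows \<open>l < 4 * i\<close> end before column \<open>16 * i\<close>, so all
    inner sums can share one range.\<close>
  have "V (V x) i = (\<Sum>l<4 * i. \<Sum>m<16 * i. complex_of_real (A i l * A l m) * x m)"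
    unfolding V_def[of "V x"]
    by (intro sum.cong refl, subst V_extend[where n = "16 * i"]) (auto simp: sum_distrib_left mult.assoc)
  also have "\<dots> = (\<Sum>m<16 * i. complex_of_real (\<Sum>l<4 * i. A i l * A l m) * x m)"
    by (subst sum.swap) (simp add: sum_distrib_right)
  finally show ?thesis
    by (simp add: A_square)
qed

text \<open>The entries of row \<open>i\<close> are at most \<open>C * i powr - a\<close>, and the
  first \<open>4 * i\<close> coordinates of \<open>x\<close> have absolute sum at most
  \<open>(4 * i) powr (1 - t)\<close> times the norm of \<open>x\<close>.\<close>

lemma V_bound:
  assumes "0 \<le> a" "a < 3 / 2"
  shows "\<exists>C\<ge>0. \<forall>x\<in>vecs E. \<forall>i. cmod (V x i) \<le> C * vnorm E x * real i powr - (a + t - 1)"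
proof -
  obtain C where C: "C \<ge> 0" "\<And>i l. \<bar>A i l\<bar> \<le> C * real i powr - a"
    using A_bound[OF assms] by blast
  have "cmod (V x i) \<le> C * 4 powr (1 - t) * vnorm E x * real i powr - (a + t - 1)"
    if x: "x \<in> vecs E" for x i
  proof -
    have "cmod (V x i) \<le> (\<Sum>l<4 * i. C * real i powr - a * cmod (x l))"
      unfolding V_def using C by (intro sum_norm_le) (simp add: norm_mult mult_right_mono)
    also have "\<dots> = C * real i powr - a * (\<Sum>l<4 * i. cmod (x l))"
      by (simp add: sum_distrib_left)
    also have "\<dots> \<le> C * real i powr - a * (card {..<4 * i} powr (1 - t) * vnorm E x)"
      using C x by (intro mult_left_mono sum_le_norm) auto
    also have "\<dots> = C * 4 powr (1 - t) * vnorm E x * (real i powr - a * real i powr (1 - t))"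
      by (simp add: powr_mult)
    also have "real i powr - a * real i powr (1 - t) = real i powr - (a + t - 1)"
      by (simp add: powr_add[symmetric] algebra_simps)
    finally show ?thesis .
  qed
  then show ?thesis
    using C by (intro exI[of _ "C * 4 powr (1 - t)"]) auto
qed

lemma V_bounded: "\<exists>B\<ge>0. \<forall>x\<in>vecs E. V x \<in> vecs E \<and> vnorm E (V x) \<le> B * vnorm E x"
proof -
  \<comment> \<open>The choice \<open>a = 5 / 4\<close> is below 3/2 and makes the decay exponent
    \<open>a + t - 1 = t + 1 / 4\<close>, which exceeds the threshold \<open>t\<close> of
    \<open>decay\<close>.\<close>
  obtain C where C: "C \<ge> 0"
    "\<And>x i. x \<in> vecs E \<Longrightarrow> cmod (V x i) \<le> C * vnorm E x * real i powr - (t + 1 / 4)"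
    using V_bound[of "5 / 4"] by (auto simp: algebra_simps)
  obtain K where K: "K \<ge> 0"
    "\<And>x C. 0 \<le> C \<Longrightarrow> \<forall>i. cmod (x i) \<le> C * real i powr - (t + 1 / 4) \<Longrightarrow> x \<in> vecs E \<and> vnorm E x \<le> C * K"
    using decay[of "t + 1 / 4"] by auto
  show ?thesis
  proof (intro exI[of _ "C * K"] conjI ballI)
    fix x assume x: "x \<in> vecs E"
    have "V x \<in> vecs E \<and> vnorm E (V x) \<le> C * vnorm E x * K"
      using C x vnorm_nonneg[OF x] by (intro K(2)) auto
    then show "V x \<in> vecs E" "vnorm E (V x) \<le> C * K * vnorm E x"
      by (auto simp: mult_ac)
  qed (use C K in simp)
qed

lemma V_add: "V (\<lambda>i. x i + y i) i = V x i + V y i"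
  by (simp add: V_def distrib_left sum.distrib)

lemma V_scale: "V (\<lambda>i. c * x i) i = c * V x i"
  by (simp add: V_def sum_distrib_left mult_ac)

lemma V_operator: "V \<in> operators E"
  using V_bounded by (auto simp: operators_def V_add V_scale)

lemma coord_in_dual: "(\<lambda>x. x i) \<in> dual E"
  using coord_le_norm by (auto simp: dual_def intro!: exI[of _ 1])

lemma V_coord_in_dual: "(\<lambda>x. V x i) \<in> dual E"
proof -
  obtain B where "\<And>x. x \<in> vecs E \<Longrightarrow> V x \<in> vecs E \<and> vnorm E (V x) \<le> B * vnorm E x"
    using V_bounded by blast
  then have "\<forall>x\<in>vecs E. cmod (V x i) \<le> B * vnorm E x"
    using coord_le_norm order_trans by blast
  then show ?thesis
    by (auto simp: dual_def V_add V_scale)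
qed

lemma summable_powr_rep:
  assumes "0 < s" "1 < b * s" "0 \<le> C"
    and "\<And>k. 0 \<le> a k" "\<And>k. a k \<le> C * real k powr - b"
  shows "summable (\<lambda>k. a k powr s)"
proof (rule summable_comparison_test')
  have "summable (\<lambda>k. real k powr (- b * s))"
    using assms(2) by (subst summable_real_powr_iff) simp
  then show "summable (\<lambda>k. C powr s * real k powr (- b * s))"
    by (rule summable_mult)
  show "norm (a k powr s) \<le> C powr s * real k powr (- b * s)" for k
    using powr_mono2[of s "a k" "C * real k powr - b"] assms by (simp add: powr_mult powr_powr)
qed

text \<open>\<open>V\<close> is expanded along its rows: the functional of row \<open>i\<close> has
  norm of order \<open>i powr - (a + t - 1)\<close> and is paired with a unit vector. For
  \<open>a\<close> close to 3/2 the powers with exponent \<open>s\<close> are summable.\<close>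

lemma V_row_representation:
  assumes s: "0 < s" "s \<le> 1" "1 / s < 1 / 2 + t"
  shows "\<exists>f v. nuclear_rep E s V f v"
proof -
  define c where "c = 1 / s"
  \<comment> \<open>The midpoint of \<open>c + 1 - t\<close> and 3/2, which gives both
    \<open>a < 3 / 2\<close> and \<open>c < a + t - 1\<close>.\<close>
  define a where "a = (3 / 2 + (c + 1 - t)) / 2"
  have cs: "c * s = 1"
    using s(1) by (simp add: c_def)
  have c: "1 \<le> c" "c < 1 / 2 + t"
    using s by (auto simp: c_def)
  then have a: "0 \<le> a" "a < 3 / 2" "c < a + t - 1"
    using t by (simp_all add: a_def field_simps)
  obtain C where C: "C \<ge> 0"
    "\<And>x i. x \<in> vecs E \<Longrightarrow> cmod (V x i) \<le> C * vnorm E x * real i powr - (a + t - 1)"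
    using V_bound[OF a(1,2)] by blast
  have "nuclear_rep E s V (\<lambda>i x. V x i) unit_vec"
    unfolding nuclear_rep_def
  proof (intro conjI allI ballI)
    fix i
    show "(\<lambda>x. V x i) \<in> dual E"
      by (rule V_coord_in_dual)
    show "unit_vec i \<in> vecs E"
      by (rule unit_vec)
  next
    have "summable (\<lambda>k. (dual_norm E (\<lambda>x. V x k) * vnorm E (unit_vec k)) powr s)"
    proof (rule summable_powr_rep[where b = "a + t - 1" and C = C])
      show "1 < (a + t - 1) * s"
        using mult_strict_right_mono[OF a(3) s(1)] cs by simp
      fix k
      show "0 \<le> dual_norm E (\<lambda>x. V x k) * vnorm E (unit_vec k)"
        using dual_norm_nonneg[OF V_coord_in_dual] vnorm_nonneg[OF unit_vec] by simp
      have "dual_norm E (\<lambda>x. V x k) \<le> C * real k powr - (a + t - 1)"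
        using C by (intro dual_norm_le) (auto simp: mult_ac)
      from mult_mono[OF this norm_unit_vec_le[of k]]
      show "dual_norm E (\<lambda>x. V x k) * vnorm E (unit_vec k) \<le> C * real k powr - (a + t - 1)"
        using C vnorm_nonneg[OF unit_vec] by simp
    qed (use s C in auto)
    then show "summable (\<lambda>k. dual_norm E (\<lambda>x. V x k) powr s * vnorm E (unit_vec k) powr s)"
      by (simp add: powr_mult)
  next
    fix x assume x: "x \<in> vecs E"
    have "V x i - (\<Sum>k<n. V x k * unit_vec k i) = (if i < n then 0 else V x i)" for n i
    proof -
      have "(\<Sum>k<n. V x k * unit_vec k i) = (\<Sum>k<n. if k = i then V x i else 0)"
        by (intro sum.cong) auto
      then show ?thesis by simp
    qed
    then show "(\<lambda>n. vnorm E (\<lambda>i. V x i - (\<Sum>k<n. V x k * unit_vec k i))) \<longlonglongrightarrow> 0"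
      using norm_tail[of "V x"] V_bounded x by auto
  qed
  then show ?thesis by blast
qed

text \<open>\<open>V\<close> is expanded along its columns: column \<open>l\<close> has its support
  below \<open>4 * l\<close> and entries of order \<open>l powr - a\<close>, hence norm of order
  \<open>l powr (t - a)\<close>, and is paired with a coordinate functional.\<close>

lemma V_column_representation:
  assumes s: "0 < s" "s \<le> 1" "1 / s < 3 / 2 - t"
  shows "\<exists>f v. nuclear_rep E s V f v"
proof -
  define c where "c = 1 / s"
  \<comment> \<open>The midpoint of \<open>c + t\<close> and 3/2, which gives both
    \<open>a < 3 / 2\<close> and \<open>c < a - t\<close>.\<close>
  define a where "a = (3 / 2 + (c + t)) / 2"
  have cs: "c * s = 1"
    using s(1) by (simp add: c_def)
  have c: "1 \<le> c" "c < 3 / 2 - t"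
    using s by (auto simp: c_def)
  then have a: "0 \<le> a" "a < 3 / 2" "c < a - t"
    using t by (simp_all add: a_def field_simps)
  obtain C where C: "C \<ge> 0" "\<And>i l. \<bar>A i l\<bar> \<le> C * real l powr - a"
    using A_bound[OF a(1,2)] by blast
  obtain B where B: "\<And>x. x \<in> vecs E \<Longrightarrow> V x \<in> vecs E \<and> vnorm E (V x) \<le> B * vnorm E x"
    using V_bounded by blast
  define col where "col l i = complex_of_real (A i l)" for l i
  have col0: "col l i = 0" if "i \<notin> {..<4 * l}" for l i
    using A_support[of i l] that by (auto simp: col_def)
  have col: "col l \<in> vecs E" for l
    by (rule finite_support[of "{..<4 * l}"]) (use col0 in auto)
  have "nuclear_rep E s V (\<lambda>l x. x l) col"
    unfolding nuclear_rep_def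
  proof (intro conjI allI ballI)
    fix l
    show "(\<lambda>x. x l) \<in> dual E"
      by (rule coord_in_dual)
    show "col l \<in> vecs E"
      by (rule col)
  next
    have "summable (\<lambda>l. (dual_norm E (\<lambda>x. x l) * vnorm E (col l)) powr s)"
    proof (rule summable_powr_rep[where b = "a - t" and C = "C * 4 powr t"])
      show "1 < (a - t) * s"
        using mult_strict_right_mono[OF a(3) s(1)] cs by simp
      fix l
      show "0 \<le> dual_norm E (\<lambda>x. x l) * vnorm E (col l)"
        using dual_norm_nonneg[OF coord_in_dual] vnorm_nonneg[OF col] by simp
      have 1: "dual_norm E (\<lambda>x. x l) \<le> 1"
        using coord_le_norm by (intro dual_norm_le) auto
      have "vnorm E (col l) \<le> C * real l powr - a * card {..<4 * l} powr t"
        using col0 C by (intro norm_le_sup) (auto simp: col_def)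
      also have "\<dots> = C * 4 powr t * (real l powr - a * real l powr t)"
        by (simp add: powr_mult)
      also have "real l powr - a * real l powr t = real l powr - (a - t)"
        by (simp add: powr_add[symmetric])
      finally show "dual_norm E (\<lambda>x. x l) * vnorm E (col l) \<le> C * 4 powr t * real l powr - (a - t)"
        using mult_mono[OF 1, of "vnorm E (col l)"] vnorm_nonneg[OF col] by simp
    qed (use s C in auto)
    then show "summable (\<lambda>l. dual_norm E (\<lambda>x. x l) powr s * vnorm E (col l) powr s)"
      by (simp add: powr_mult)
  next
    fix x assume x: "x \<in> vecs E"
    define tail where "tail n i = (if i < n then 0 else x i)" for n i
    have tail: "tail n \<in> vecs E" for n
      by (rule solid[OF x]) (simp add: tail_def)
    \<comment> \<open>The remainder after \<open>n\<close> columns is the image of the tail of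
      \<open>x\<close>, so it tends to 0 because \<open>V\<close> is bounded.\<close>
    have "V x i - (\<Sum>k<n. x k * col k i) = V (tail n) i" for n i
    proof -
      define N where "N = max n (4 * i)"
      have "(\<Sum>k<n. x k * col k i) = (\<Sum>k<N. if k < n then complex_of_real (A i k) * x k else 0)"
      proof (rule sum.mono_neutral_cong_left)
        show "{..<n} \<subseteq> {..<N}"
          by (auto simp: N_def)
      qed (simp_all add: col_def mult.commute)
      then have "V x i - (\<Sum>k<n. x k * col k i) = (\<Sum>k<N. complex_of_real (A i k) * tail n k)"
        using V_extend[of i N x] by (auto simp: sum_subtractf[symmetric] N_def tail_def intro!: sum.cong)
      then show ?thesis
        using V_extend[of i N "tail n"] by (simp add: N_def)
    qed
    moreover have "(\<lambda>n. vnorm E (V (tail n))) \<longlonglongrightarrow> 0"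
    proof (rule Lim_null_comparison)
      show "eventually (\<lambda>n. norm (vnorm E (V (tail n))) \<le> B * vnorm E (tail n)) sequentially"
        using B[OF tail] vnorm_nonneg by (intro always_eventually) auto
      have "(\<lambda>n. vnorm E (tail n)) \<longlonglongrightarrow> 0"
        using norm_tail[OF x] by (simp add: tail_def[abs_def])
      from tendsto_mult_right_zero[OF this] show "(\<lambda>n. B * vnorm E (tail n)) \<longlonglongrightarrow> 0" .
    qed
    ultimately show "(\<lambda>n. vnorm E (\<lambda>i. V x i - (\<Sum>k<n. x k * col k i))) \<longlonglongrightarrow> 0"
      by simp
  qed
  then show ?thesis by blast
qed

text \<open>The larger of the row bound \<open>1 / 2 + t\<close> and the column bound
  \<open>3 / 2 - t\<close> is \<open>1 + \<bar>1 / 2 - t\<bar>\<close>.\<close>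

lemma V_nuclear:
  assumes "0 < s" "s \<le> 1" "1 / s < 1 + \<bar>1 / 2 - t\<bar>"
  shows "V \<in> nuclear_ops E s"
proof -
  have "1 / s < 1 / 2 + t \<or> 1 / s < 3 / 2 - t"
    using assms(3) by linarith
  then show ?thesis
    using V_row_representation[OF assms(1,2)] V_column_representation[OF assms(1,2)] V_operator
    by (auto simp: nuclear_ops_def)
qed

text \<open>In the bases \<open>p k\<close> and \<open>q (Suc k)\<close> the representation
  decomposes \<open>\<tau>\<close> times the identity of size \<open>m\<close>, so
  \<open>scalar_matrix_decomposition_lower_bound\<close> applies. Passing from Hilbert space norms
  to those of \<open>E\<close> and its dual costs \<open>(4 * m) powr \<delta>\<close>, whose power
  with exponent \<open>r\<close> matches the growth of \<open>\<tau> powr r * m\<close> in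
  \<open>m\<close>. The right-hand side is the same for all \<open>k\<close>.\<close>

lemma nuclear_rep_level_bound:
  fixes k :: nat
  assumes rep: "nuclear_rep E r V f v" and r: "0 < r" "1 / r = 1 + \<bar>1 / 2 - t\<bar>"
  shows "(real k + 1) powr r \<le> 8 * (\<Sum>\<kappa>. dual_norm E (f \<kappa>) powr r * vnorm E (v \<kappa>) powr r)"
proof -
  define m :: nat where "m = 2 * 2 ^ k"
  define \<delta> where "\<delta> = \<bar>1 / 2 - t\<bar>"
  have m: "m > 0" by (simp add: m_def)
  \<comment> \<open>\<open>\<delta> * r = 1 - r\<close> is the equation for \<open>r\<close>
    multiplied by \<open>r\<close>; it is what makes the powers of \<open>m\<close> cancel at the
    end.\<close>
  have \<delta>: "\<delta> \<ge> 0" "\<delta> = max (1 / 2 - t) 0 + max (t - 1 / 2) 0" "\<delta> * r = 1 - r" "r \<le> 1"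
  proof -
    show "\<delta> \<ge> 0" "\<delta> = max (1 / 2 - t) 0 + max (t - 1 / 2) 0"
      by (auto simp: \<delta>_def)
    have "1 + \<delta> = 1 / r"
      using r(2) by (simp add: \<delta>_def)
    then have "(1 + \<delta>) * r = 1"
      using r(1) by simp
    then show "\<delta> * r = 1 - r"
      by (simp add: algebra_simps)
    moreover have "0 \<le> \<delta> * r"
      using r(1) \<open>0 \<le> \<delta>\<close> by simp
    ultimately show "r \<le> 1"
      by simp
  qed
  have f: "f \<kappa> \<in> dual E" and v: "v \<kappa> \<in> vecs E" for \<kappa>
    using rep by (auto simp: nuclear_rep_def)
  define c where "c \<kappa> = dual_norm E (f \<kappa>) powr r * vnorm E (v \<kappa>) powr r" for \<kappa>
  have c: "summable c"
    using rep by (simp add: nuclear_rep_def c_def[abs_def])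
  define u where "u \<kappa> j = (\<Sum>i\<in>block k. p k j i * v \<kappa> i)" for \<kappa> j
  \<comment> \<open>The minus sign turns the off-diagonal block, a negative multiple of the
    identity, into a positive one.\<close>
  define g where "g \<kappa> j = - (\<Sum>l\<in>block (Suc k). q (Suc k) j l * f \<kappa> (unit_vec l))" for \<kappa> j
  define a where "a \<kappa> = L2_set (\<lambda>i. cmod (u \<kappa> i)) {..<m} * L2_set (\<lambda>i. cmod (g \<kappa> i)) {..<m}" for \<kappa>
  have a_le: "a \<kappa> powr r \<le> (4 * real m) powr (1 - r) * c \<kappa>" for \<kappa>
  proof -
    \<comment> \<open>The two blocks have \<open>2 * m\<close> and \<open>4 * m\<close> elements;
      the larger number serves for both.\<close>
    have card: "real (card (block k)) \<le> 4 * real m" "real (card (block (Suc k))) \<le> 4 * real m"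
      by (auto simp: block_def m_def)
    have "L2_set (\<lambda>i. cmod (u \<kappa> i)) {..<m} \<le> L2_set (\<lambda>i. cmod (v \<kappa> i)) (block k)"
      unfolding u_def by (rule bessel_inequality) (auto simp: p_orth m_def)
    also have "\<dots> \<le> card (block k) powr max (1 / 2 - t) 0 * vnorm E (v \<kappa>)"
      by (rule L2_set_le_norm[OF finite_block v])
    also have "\<dots> \<le> (4 * real m) powr max (1 / 2 - t) 0 * vnorm E (v \<kappa>)"
      using card vnorm_nonneg[OF v] by (intro mult_right_mono powr_mono2) auto
    finally have 1: "L2_set (\<lambda>i. cmod (u \<kappa> i)) {..<m} \<le> (4 * real m) powr max (1 / 2 - t) 0 * vnorm E (v \<kappa>)" .
    have "L2_set (\<lambda>i. cmod (g \<kappa> i)) {..<m} \<le> L2_set (\<lambda>l. cmod (f \<kappa> (unit_vec l))) (block (Suc k))"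
      unfolding g_def norm_minus_cancel by (rule bessel_inequality) (auto simp: q_orth m_def)
    also have "\<dots> \<le> card (block (Suc k)) powr max (t - 1 / 2) 0 * dual_norm E (f \<kappa>)"
      by (rule L2_set_apply_unit_vec_le[OF f finite_block])
    also have "\<dots> \<le> (4 * real m) powr max (t - 1 / 2) 0 * dual_norm E (f \<kappa>)"
      using card dual_norm_nonneg[OF f] by (intro mult_right_mono powr_mono2) auto
    finally have "a \<kappa> \<le> ((4 * real m) powr max (1 / 2 - t) 0 * vnorm E (v \<kappa>)) *
        ((4 * real m) powr max (t - 1 / 2) 0 * dual_norm E (f \<kappa>))"
      unfolding a_def using 1 vnorm_nonneg[OF v] by (intro mult_mono) (auto simp: L2_set_nonneg)
    also have "\<dots> = (4 * real m) powr \<delta> * (dual_norm E (f \<kappa>) * vnorm E (v \<kappa>))"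
      unfolding \<delta>(2) powr_add by (simp add: mult_ac)
    finally have "a \<kappa> powr r \<le> ((4 * real m) powr \<delta> * (dual_norm E (f \<kappa>) * vnorm E (v \<kappa>))) powr r"
      using r by (intro powr_mono2) (auto simp: a_def L2_set_nonneg)
    then show ?thesis
      by (simp only: powr_mult powr_powr \<delta>(3) c_def)
  qed
  have a_summable: "summable (\<lambda>\<kappa>. a \<kappa> powr r)"
    by (rule summable_comparison_test'[OF summable_mult[OF c]]) (use a_le in auto)
  define \<tau> where "\<tau> = (real k + 1) / m"
  have \<tau>: "0 < \<tau>"
    using m by (simp add: \<tau>_def)
  have "\<tau> powr r * m / 2 \<le> (\<Sum>\<kappa>. a \<kappa> powr r)"
    unfolding a_def
  proof (rule scalar_matrix_decomposition_lower_bound)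
    show "summable (\<lambda>\<kappa>. (L2_set (\<lambda>i. cmod (u \<kappa> i)) {..<m} * L2_set (\<lambda>i. cmod (g \<kappa> i)) {..<m}) powr r)"
      using a_summable by (simp add: a_def)
    fix i j assume ij: "i < m" "j < m"
    have "(\<lambda>\<kappa>. \<Sum>x\<in>block k. \<Sum>l\<in>block (Suc k). (- complex_of_real (p k i x * q (Suc k) j l)) * (f \<kappa> (unit_vec l) * v \<kappa> x))
      sums (\<Sum>x\<in>block k. \<Sum>l\<in>block (Suc k). (- complex_of_real (p k i x * q (Suc k) j l)) * V (unit_vec l) x)"
      using V_operator unit_vec
      by (intro sums_sum sums_mult nuclear_rep_sums_coord[OF rep]) (auto simp: operators_def)
    also have "(\<lambda>\<kappa>. \<Sum>x\<in>block k. \<Sum>l\<in>block (Suc k). (- complex_of_real (p k i x * q (Suc k) j l)) * (f \<kappa> (unit_vec l) * v \<kappa> x))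
      = (\<lambda>\<kappa>. u \<kappa> i * g \<kappa> j)"
      by (simp add: u_def g_def sum_product sum_negf mult_ac)
    also have "(\<Sum>x\<in>block k. \<Sum>l\<in>block (Suc k). (- complex_of_real (p k i x * q (Suc k) j l)) * V (unit_vec l) x)
      = complex_of_real (- (\<Sum>x\<in>block k. \<Sum>l\<in>block (Suc k). p k i x * A x l * q (Suc k) j l))"
      unfolding V_unit_vec by (simp add: sum_negf mult_ac)
    also have "- (\<Sum>x\<in>block k. \<Sum>l\<in>block (Suc k). p k i x * A x l * q (Suc k) j l) = (if i = j then \<tau> else 0)"
      using A_off_diag_block[of i k j] ij by (simp add: m_def \<tau>_def field_simps)
    also have "complex_of_real \<dots> = (if i = j then complex_of_real \<tau> else 0)"
      by simp
    finally show "(\<lambda>\<kappa>. u \<kappa> i * g \<kappa> j) sums (if i = j then complex_of_real \<tau> else 0)" .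
  qed (use \<tau> r(1) \<delta>(4) in auto)
  also have "\<dots> \<le> (\<Sum>\<kappa>. (4 * real m) powr (1 - r) * c \<kappa>)"
    by (rule suminf_le[OF a_le a_summable summable_mult[OF c]])
  also have "\<dots> = (4 powr (1 - r) * real m powr (1 - r)) * suminf c"
    unfolding suminf_mult[OF c] powr_mult ..
  \<comment> \<open>Both sides now carry \<open>m powr (1 - r)\<close>. After cancellation
    \<open>2 * 4 powr (1 - r)\<close> remains, and 8 is a bound for it.\<close>
  also have "\<tau> powr r * m / 2 = (real k + 1) powr r * real m powr (1 - r) / 2"
    using m by (simp add: \<tau>_def powr_divide powr_diff)
  finally have "real m powr (1 - r) * (real k + 1) powr r \<le> real m powr (1 - r) * (2 * 4 powr (1 - r) * suminf c)"
    by (simp add: mult_ac)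
  then have "(real k + 1) powr r \<le> 2 * 4 powr (1 - r) * suminf c"
    using m by simp
  also have "\<dots> \<le> 2 * 4 powr 1 * suminf c"
    using r c by (intro mult_right_mono mult_left_mono powr_mono suminf_nonneg) (auto simp: c_def)
  finally show ?thesis
    by (simp add: c_def[abs_def])
qed

text \<open>A single representation would bound \<open>(k + 1) powr r\<close> by one constant for
  all levels \<open>k\<close>.\<close>

lemma V_not_nuclear:
  assumes r: "0 < r" "1 / r = 1 + \<bar>1 / 2 - t\<bar>"
  shows "V \<notin> nuclear_ops E r"
proof
  assume "V \<in> nuclear_ops E r"
  then obtain f v where "nuclear_rep E r V f v"
    by (auto simp: nuclear_ops_def)
  from nuclear_rep_level_bound[OF this r] obtain W where W: "\<And>k :: nat. (real k + 1) powr r \<le> W"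
    by blast
  have "filterlim (\<lambda>k :: nat. (real k + 1) powr r) at_top sequentially"
    using r by real_asymp
  then have "eventually (\<lambda>k :: nat. W < (real k + 1) powr r) sequentially"
    by (simp add: filterlim_at_top_dense)
  then show False
    using W by (auto simp: eventually_sequentially not_less[symmetric])
qed

text \<open>For \<open>t \<noteq> 1 / 2\<close> the exponent 1 is strictly inside the range of
  \<open>V_nuclear\<close>, so the trace can be read off the diagonal of \<open>A\<close>.\<close>

lemma V_trace:
  assumes "t \<noteq> 1 / 2"
  shows "nuclear_trace E V = 1"
proof (rule nuclear_trace_eq)
  show "V \<in> nuclear_ops E 1"
    using assms by (intro V_nuclear) auto
  show "(\<lambda>i. V (unit_vec i) i) sums 1"
    using sums_of_real[OF A_diag_sums, where 'a = complex] by (simp add: V_unit_vec)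
qed

end

theorem theorem2:
  fixes p :: ereal and r :: real
  assumes "1 \<le> p" and "p \<noteq> 2"
    and "1 / r = 1 + \<bar>1 / 2 - real_of_ereal (1 / p)\<bar>"
  shows "\<exists>V \<in> nuclear_ops (lp_or_c0 p) 1.
           (\<forall>s\<in>{r<..1}. V \<in> nuclear_ops (lp_or_c0 p) s) \<and>
           V \<notin> nuclear_ops (lp_or_c0 p) r \<and>
           nuclear_trace (lp_or_c0 p) V = 1 \<and>
           (\<forall>x\<in>vecs (lp_or_c0 p). V (V x) = (\<lambda>i. 0))"
proof -
  define t where "t = real_of_ereal (1 / p)"
  \<comment> \<open>For \<open>p = \<infinity>\<close> the value \<open>1 / p\<close> is 0 in the
    extended reals, which matches \<open>c_0\<close>; \<open>p \<noteq> 2\<close> turns into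
    \<open>t \<noteq> 1 / 2\<close>.\<close>
  have lattice: "sequence_lattice (lp_or_c0 p) t \<and> t \<noteq> 1 / 2"
  proof (cases p)
    case (real x)
    then have "1 \<le> x" "x \<noteq> 2"
      using assms(1,2) by auto
    moreover have "t = 1 / x"
      using real \<open>1 \<le> x\<close> by (simp add: t_def divide_ereal_def field_simps)
    ultimately show ?thesis
      using real lp_sequence_lattice[of x] by (simp add: lp_or_c0_def)
  next
    case PInf
    then show ?thesis
      using c0_sequence_lattice by (simp add: t_def lp_or_c0_def)
  next
    case MInf
    then show ?thesis
      using assms(1) by simp
  qed
  interpret L: sequence_lattice "lp_or_c0 p" t
    by (rule conjunct1[OF lattice])
  have t: "t \<noteq> 1 / 2"
    by (rule conjunct2[OF lattice])
  obtain P Q where "frames P Q"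
    using ex_frames by blast
  then interpret F: frames P Q .
  interpret frames_on_lattice "lp_or_c0 p" t P Q ..
  have r: "1 / r = 1 + \<bar>1 / 2 - t\<bar>" "0 < r"
  proof -
    show "1 / r = 1 + \<bar>1 / 2 - t\<bar>"
      using assms(3) by (simp add: t_def)
    \<comment> \<open>The right-hand side is at least 1; as \<open>1 / 0 = 0\<close>, this also
      excludes \<open>r = 0\<close>.\<close>
    then have "0 < 1 / r"
      by (simp only:)
    then show "0 < r"
      by simp
  qed
  have "V \<in> nuclear_ops (lp_or_c0 p) s" if "s \<in> {r<..1}" for s
  proof (rule V_nuclear)
    show "0 < s" "s \<le> 1"
      using that r by auto
    have "1 / s < 1 / r"
      using that r(2) by (intro divide_strict_left_mono) auto
    then show "1 / s < 1 + \<bar>1 / 2 - t\<bar>"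
      using r by simp
  qed
  moreover have "V \<in> nuclear_ops (lp_or_c0 p) 1"
    using t by (intro V_nuclear) auto
  ultimately show ?thesis
    using V_not_nuclear[OF r(2,1)] V_trace[OF t] V_V by blast
qed

end
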